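(* Let $\mathcal M,\mathcal N$ be connected, compact, oriented smooth $2$-dimensional Riemannian manifolds (possibly with Lipschitz boundaries). Let $\phi\in C^2(\mathcal M,\mathcal N)$ with $J\phi>0$ and $d\phi\in K$ (everywhere). Then $\phi$ is a critical point of $E_2$; and for $p\ge1$, $p\ne2$, $\phi$ is a critical point of $E_p$ if and only if the singular values of $d\phi$ are constant on $\mathcal M$.
   Context: Write $\mathfrak g,\mathfrak h$ for the metrics; $J\phi$ is the determinant of $d\phi$ with respect to metrics and orientations. $K$ is the set of linear maps $A$ between oriented $2$-dimensional inner product spaces with $\det A\ge0$ and $\sigma_1(A)+\sigma_2(A)=1$, where $\sigma_i(A)$ are the singular values; $d\phi\in K$ means $d\phi_x\in K$ with respect to $\mathfrak g_x,\mathfrak h_{\phi(x)}$. $\operatorname{SO}(\mathfrak g,\phi^*\mathfrak h)_x$ is the set of orientation-preserving linear isometries $T_x\mathcal M\to T_{\phi(x)}\mathcal N$, distances are taken with respect to the inner product on $\operatorname{Hom}(T_x\mathcal M,T_{\phi(x)}\mathcal N)$ induced by $\mathfrak g,\mathfrak h$, and $$E_p(\phi)=\frac1{V_{\mathcal M}}\int_{\mathcal M}\operatorname{dist}^p\big(d\phi,\operatorname{SO}(\mathfrak g,\phi^*\mathfrak h)\big),$$ with $V_{\mathcal M}$ the area of $\mathcal M$. For $J\phi>0$, $O(d\phi)$ denotes the orthogonal polar factor of $d\phi$, i.e. the unique section of $\operatorname{SO}(\mathfrak g,\phi^*\mathfrak h)$ closest to $d\phi$. A $C^2$ map $\phi$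 with $J\phi>0$ is a critical point of $E_p$ if it satisfies the Euler–Lagrange equation $$\delta\Big(\operatorname{dist}^{p-2}\big(d\phi,\operatorname{SO}(\mathfrak g,\phi^*\mathfrak h)\big)\,\big(d\phi-O(d\phi)\big)\Big)=0$$ (for $p=2$: $\delta(d\phi-O(d\phi))=0$), where for a $\phi^*T\mathcal N$-valued one-form $\omega$, $\delta\omega=-\sum_i(\nabla_{E_i}\omega)(E_i)$, $(E_i)$ a local orthonormal frame of $T\mathcal M$ and $\nabla$ the connection on $T^*\mathcal M\otimes\phi^*T\mathcal N$ induced by the Levi-Civita connections. *)

theory Defs
  imports "HOL-Analysis.Analysis"
begin

section \<open>Maps between oriented two-dimensional inner product spaces\<close>

text \<open>
  An oriented two-dimensional inner product space is represented in positively oriented linear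
  coordinates: it is \<^typ>\<open>real^2\<close> with its standard orientation and with the inner product
  \<open>v \<bullet> (G *v w)\<close> given by a Gram matrix \<open>G\<close>. Below, \<open>G\<close> and \<open>H\<close> are the Gram matrices of the domain
  and of the codomain of a linear map \<open>A\<close>.
\<close>

definition gram_matrix :: "real^2^2 \<Rightarrow> bool" where
  "gram_matrix G \<longleftrightarrow> transpose G = G \<and> (\<forall>v. v \<noteq> 0 \<longrightarrow> v \<bullet> (G *v v) > 0)"

definition orthonormal_frame :: "real^2^2 \<Rightarrow> (2 \<Rightarrow> real^2) \<Rightarrow> bool" where
  "orthonormal_frame G e \<longleftrightarrow> (\<forall>i j. e i \<bullet> (G *v e j) = (if i = j then 1 else 0))"

text \<open>The adjoint is determined by \<open>(A *v v) \<bullet> (H *v w) = v \<bullet> (G *v (adj *v w))\<close>.\<close>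

definition adjoint_map :: "real^2^2 \<Rightarrow> real^2^2 \<Rightarrow> real^2^2 \<Rightarrow> real^2^2" where
  "adjoint_map G H A = matrix_inv G ** transpose A ** H"

text \<open>
  The singular values are the square roots of the eigenvalues of \<open>A\<^sup>* A\<close>. This map is self-adjoint on
  a two-dimensional space, so its largest and smallest eigenvalues are all its eigenvalues, also
  when there is only one, of multiplicity two.
\<close>

definition gram_eigenvalues :: "real^2^2 \<Rightarrow> real^2^2 \<Rightarrow> real^2^2 \<Rightarrow> real set" where
  "gram_eigenvalues G H A = {l. \<exists>v. v \<noteq> 0 \<and> (adjoint_map G H A ** A) *v v = l *\<^sub>R v}"

definition sigma1 :: "real^2^2 \<Rightarrow> real^2^2 \<Rightarrow> real^2^2 \<Rightarrow> real" where
  "sigma1 G H A = sqrt (Max (gram_eigenvalues G H A))"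

definition sigma2 :: "real^2^2 \<Rightarrow> real^2^2 \<Rightarrow> real^2^2 \<Rightarrow> real" where
  "sigma2 G H A = sqrt (Min (gram_eigenvalues G H A))"

text \<open>
  The determinant of \<open>A\<close> with respect to positively oriented orthonormal bases: such bases are
  obtained from the coordinate bases by matrices of determinant \<open>1 / sqrt (det G)\<close> and
  \<open>1 / sqrt (det H)\<close>.
\<close>

definition metric_det :: "real^2^2 \<Rightarrow> real^2^2 \<Rightarrow> real^2^2 \<Rightarrow> real" where
  "metric_det G H A = sqrt (det H) * det A / sqrt (det G)"

definition K_set :: "real^2^2 \<Rightarrow> real^2^2 \<Rightarrow> (real^2^2) set" where
  "K_set G H = {A. metric_det G H A \<ge> 0 \<and> sigma1 G H A + sigma2 G H A = 1}"

definition SO_set :: "real^2^2 \<Rightarrow> real^2^2 \<Rightarrow> (real^2^2) set" where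
  "SO_set G H =
     {Q. det Q > 0 \<and> (\<forall>v w. (Q *v v) \<bullet> (H *v (Q *v w)) = v \<bullet> (G *v w))}"

definition hom_norm :: "real^2^2 \<Rightarrow> real^2^2 \<Rightarrow> real^2^2 \<Rightarrow> real" where
  "hom_norm G H A = sqrt (trace (adjoint_map G H A ** A))"

definition dist_SO :: "real^2^2 \<Rightarrow> real^2^2 \<Rightarrow> real^2^2 \<Rightarrow> real" where
  "dist_SO G H A = (INF Q\<in>SO_set G H. hom_norm G H (A - Q))"

definition polar_factor :: "real^2^2 \<Rightarrow> real^2^2 \<Rightarrow> real^2^2 \<Rightarrow> real^2^2" where
  "polar_factor G H A = (THE Q. Q \<in> SO_set G H \<and> hom_norm G H (A - Q) = dist_SO G H A)"


section \<open>Functions of class \<open>C\<^sup>k\<close> on Lipschitz regions\<close>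

text \<open>
  Regularity at boundary points is understood through derivatives relative to the region \<open>S\<close>. These
  are unique on the Lipschitz regions below, since near each of its points such a region contains
  truncated cones with non-empty interior and apex at that point.
\<close>

definition pderiv_on ::
    "(real^2) set \<Rightarrow> 2 \<Rightarrow> (real^2 \<Rightarrow> 'b::real_normed_vector) \<Rightarrow> real^2 \<Rightarrow> 'b" where
  "pderiv_on S i f z = frechet_derivative f (at z within S) (axis i 1)"

primrec Ck_on :: "nat \<Rightarrow> (real^2 \<Rightarrow> 'b::real_normed_vector) \<Rightarrow> (real^2) set \<Rightarrow> bool" where
  "Ck_on 0 f S \<longleftrightarrow> continuous_on S f"
| "Ck_on (Suc k) f S \<longleftrightarrow> f differentiable_on S \<and> (\<forall>i. Ck_on k (pderiv_on S i f) S)"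

definition smooth_on :: "(real^2 \<Rightarrow> 'b::real_normed_vector) \<Rightarrow> (real^2) set \<Rightarrow> bool" where
  "smooth_on f S \<longleftrightarrow> (\<forall>k. Ck_on k f S)"

text \<open>
  Near each of its points the set is a full neighbourhood or, in suitable orthonormal coordinates,
  the epigraph of a Lipschitz function.
\<close>

definition lipschitz_region :: "(real^2) set \<Rightarrow> bool" where
  "lipschitz_region S \<longleftrightarrow> (\<forall>z\<in>S. z \<in> interior S \<or>
     (\<exists>r>0. \<exists>u v f L. norm u = 1 \<and> norm v = 1 \<and> u \<bullet> v = 0 \<and> L-lipschitz_on UNIV f \<and>
        S \<inter> ball z r = {y \<in> ball z r. (f :: real \<Rightarrow> real) (u \<bullet> y) \<le> v \<bullet> y}))"


section \<open>Oriented Riemannian surfaces, possibly with Lipschitz boundary\<close>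

type_synonym 'a chart = "'a set \<times> ('a \<Rightarrow> real^2)"

text \<open>
  \<open>metric M c z\<close> is the Gram matrix of the metric in the coordinates of the chart \<open>c\<close>, at the point
  with coordinates \<open>z\<close>.
\<close>

record 'a surface =
  topo :: "'a topology"
  charts :: "'a chart set"
  metric :: "'a chart \<Rightarrow> real^2 \<Rightarrow> real^2^2"

definition chart_inv :: "'a chart \<Rightarrow> real^2 \<Rightarrow> 'a" where
  "chart_inv c = inv_into (fst c) (snd c)"

definition is_chart :: "'a topology \<Rightarrow> 'a chart \<Rightarrow> bool" where
  "is_chart X c \<longleftrightarrow> openin X (fst c) \<and> lipschitz_region (snd c ` fst c) \<and>
     homeomorphic_map (subtopology X (fst c)) (top_of_set (snd c ` fst c)) (snd c)"

definition overlap :: "'a chart \<Rightarrow> 'a chart \<Rightarrow> (real^2) set" where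
  "overlap c d = snd c ` (fst c \<inter> fst d)"

definition transition :: "'a chart \<Rightarrow> 'a chart \<Rightarrow> real^2 \<Rightarrow> real^2" where
  "transition c d = snd d \<circ> chart_inv c"

definition oriented_smooth_atlas :: "'a topology \<Rightarrow> 'a chart set \<Rightarrow> bool" where
  "oriented_smooth_atlas X \<A> \<longleftrightarrow>
     (\<forall>c\<in>\<A>. is_chart X c) \<and> (\<Union>c\<in>\<A>. fst c) = topspace X \<and>
     (\<forall>c\<in>\<A>. \<forall>d\<in>\<A>. smooth_on (transition c d) (overlap c d) \<and>
        (\<forall>z\<in>overlap c d. det (jacobian (transition c d) (at z within overlap c d)) > 0))"

definition riemannian_metric ::
    "'a chart set \<Rightarrow> ('a chart \<Rightarrow> real^2 \<Rightarrow> real^2^2) \<Rightarrow> bool" where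
  "riemannian_metric \<A> g \<longleftrightarrow>
     (\<forall>c\<in>\<A>. smooth_on (g c) (snd c ` fst c) \<and> (\<forall>z\<in>snd c ` fst c. gram_matrix (g c z))) \<and>
     (\<forall>c\<in>\<A>. \<forall>d\<in>\<A>. \<forall>z\<in>overlap c d.
        let D = jacobian (transition c d) (at z within overlap c d)
        in g c z = transpose D ** g d (transition c d z) ** D)"

definition oriented_riemannian_surface :: "'a surface \<Rightarrow> bool" where
  "oriented_riemannian_surface M \<longleftrightarrow>
     Hausdorff_space (topo M) \<and> second_countable (topo M) \<and>
     oriented_smooth_atlas (topo M) (charts M) \<and> riemannian_metric (charts M) (metric M)"


section \<open>Maps between surfaces in local coordinates\<close>

definition local_dom :: "'a chart \<Rightarrow> 'b chart \<Rightarrow> ('a \<Rightarrow> 'b) \<Rightarrow> (real^2) set" where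
  "local_dom c d \<phi> = snd c ` {x \<in> fst c. \<phi> x \<in> fst d}"

definition local_rep :: "'a chart \<Rightarrow> 'b chart \<Rightarrow> ('a \<Rightarrow> 'b) \<Rightarrow> real^2 \<Rightarrow> real^2" where
  "local_rep c d \<phi> = snd d \<circ> \<phi> \<circ> chart_inv c"

definition local_differential ::
    "'a chart \<Rightarrow> 'b chart \<Rightarrow> ('a \<Rightarrow> 'b) \<Rightarrow> real^2 \<Rightarrow> real^2^2" where
  "local_differential c d \<phi> z = jacobian (local_rep c d \<phi>) (at z within local_dom c d \<phi>)"

definition C2_map :: "'a surface \<Rightarrow> 'b surface \<Rightarrow> ('a \<Rightarrow> 'b) \<Rightarrow> bool" where
  "C2_map M N \<phi> \<longleftrightarrow> continuous_map (topo M) (topo N) \<phi> \<and>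
     (\<forall>c\<in>charts M. \<forall>d\<in>charts N. Ck_on 2 (local_rep c d \<phi>) (local_dom c d \<phi>))"

text \<open>
  \<open>P\<close> holds for the differential of \<open>\<phi>\<close> at every point of \<open>M\<close>. The intended \<open>P G H A\<close> are invariant
  under orientation-preserving changes of linear coordinates, so the choice of charts is immaterial.
\<close>

definition differential_satisfies ::
    "'a surface \<Rightarrow> 'b surface \<Rightarrow> ('a \<Rightarrow> 'b) \<Rightarrow> (real^2^2 \<Rightarrow> real^2^2 \<Rightarrow> real^2^2 \<Rightarrow> bool) \<Rightarrow> bool" where
  "differential_satisfies M N \<phi> P \<longleftrightarrow>
     (\<forall>c\<in>charts M. \<forall>d\<in>charts N. \<forall>z\<in>local_dom c d \<phi>.
        P (metric M c z) (metric N d (local_rep c d \<phi> z)) (local_differential c d \<phi> z))"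


section \<open>The Euler-Lagrange equation\<close>

text \<open>
  \<open>christoffel S g z k i j\<close> is the Christoffel symbol of the Levi-Civita connection with upper
  index \<open>k\<close> and lower indices \<open>i\<close>, \<open>j\<close>.
\<close>

definition christoffel ::
    "(real^2) set \<Rightarrow> (real^2 \<Rightarrow> real^2^2) \<Rightarrow> real^2 \<Rightarrow> 2 \<Rightarrow> 2 \<Rightarrow> 2 \<Rightarrow> real" where
  "christoffel S g z k i j = (\<Sum>l\<in>UNIV. matrix_inv (g z) $ k $ l *
     (pderiv_on S i (\<lambda>y. g y $ j $ l) z + pderiv_on S j (\<lambda>y. g y $ i $ l) z
      - pderiv_on S l (\<lambda>y. g y $ i $ j) z)) / 2"

lemma gram_matrix_sym:
  assumes "gram_matrix G"
  shows "G $ i $ j = G $ j $ i"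
proof -
  have "transpose G $ j $ i = G $ j $ i" using assms by (simp add: gram_matrix_def)
  then show ?thesis by (simp add: transpose_def)
qed

lemma pderiv_on_cong:
  assumes "z \<in> S" and eq: "\<And>y. y \<in> S \<Longrightarrow> f y = f' y"
  shows "pderiv_on S i f z = pderiv_on S i f' z"
proof -
  have "(f has_derivative D) (at z within S) \<longleftrightarrow> (f' has_derivative D) (at z within S)" for D
    using has_derivative_transform[OF assms(1), of f f' D]
      has_derivative_transform[OF assms(1), of f' f D] eq by auto
  then show ?thesis unfolding pderiv_on_def frechet_derivative_def by presburger
qed

lemma christoffel_torsion_free:
  assumes "z \<in> S" and "\<And>y. y \<in> S \<Longrightarrow> gram_matrix (g y)"
  shows "christoffel S g z k i j = christoffel S g z k j i"
proof -
  have sym: "g y $ i $ j = g y $ j $ i" if "y \<in> S" for y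
    using assms(2)[OF that] by (rule gram_matrix_sym)
  have psym: "pderiv_on S l (\<lambda>y. g y $ i $ j) z = pderiv_on S l (\<lambda>y. g y $ j $ i) z" for l
    using assms(1) sym by (rule pderiv_on_cong)
  show ?thesis unfolding christoffel_def psym by (simp add: add.commute)
qed

lemma christoffel_metric_compatible:
  assumes "z \<in> S" and gram: "\<And>y. y \<in> S \<Longrightarrow> gram_matrix (g y)"
  shows "pderiv_on S k (\<lambda>y. g y $ i $ j) z =
           (\<Sum>m\<in>UNIV. christoffel S g z m k i * g z $ m $ j + christoffel S g z m k j * g z $ i $ m)"
proof -
  have sym: "g y $ a $ b = g y $ b $ a" if "y \<in> S" for y a b
    using gram[OF that] by (rule gram_matrix_sym)
  have psym: "pderiv_on S l (\<lambda>y. g y $ a $ b) z = pderiv_on S l (\<lambda>y. g y $ b $ a) z" for l a b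
    using assms(1) sym by (rule pderiv_on_cong)
  have "invertible (g z)"
  proof -
    have "v = 0" if "g z *v v = 0" for v
      using gram[OF assms(1)] that unfolding gram_matrix_def by (metis inner_zero_right less_irrefl)
    then show ?thesis
      by (meson invertible_left_inverse matrix_left_invertible_ker)
  qed
  then have "g z ** matrix_inv (g z) = mat 1" 
    unfolding invertible_def matrix_inv_def by (metis (mono_tags, lifting) someI_ex)
  then have "(g z ** matrix_inv (g z)) $ a $ l = mat 1 $ a $ l" for a l by simp
  then have inv: "(\<Sum>m\<in>UNIV. g z $ a $ m * matrix_inv (g z) $ m $ l) = (if a = l then 1 else 0)"
    for a l by (simp add: mat_def matrix_matrix_mult_def)
  have low: "(\<Sum>m\<in>UNIV. g z $ a $ m * christoffel S g z m b c) =
     (pderiv_on S b (\<lambda>y. g y $ c $ a) z + pderiv_on S c (\<lambda>y. g y $ b $ a) z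
      - pderiv_on S a (\<lambda>y. g y $ b $ c) z) / 2" (is "_ = ?T a / 2") for a b c
  proof -
    have "(\<Sum>m\<in>UNIV. g z $ a $ m * christoffel S g z m b c)
        = (\<Sum>m\<in>UNIV. \<Sum>l\<in>UNIV. g z $ a $ m * matrix_inv (g z) $ m $ l * (?T l / 2))"
      by (simp add: christoffel_def sum_distrib_left sum_divide_distrib mult.assoc)
    also have "\<dots> = (\<Sum>l\<in>UNIV. (\<Sum>m\<in>UNIV. g z $ a $ m * matrix_inv (g z) $ m $ l) * (?T l / 2))"
      unfolding sum_distrib_right by (rule sum.swap)
    also have "\<dots> = ?T a / 2" unfolding inv by (simp only: if_distrib[of "\<lambda>x. x * _"] mult_1 mult_zero_left sum.delta' finite UNIV_I if_True
          cong: if_cong)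
    finally show ?thesis .
  qed
  have "(\<Sum>m\<in>UNIV. christoffel S g z m k i * g z $ m $ j + christoffel S g z m k j * g z $ i $ m)
      = (\<Sum>m\<in>UNIV. g z $ j $ m * christoffel S g z m k i)
        + (\<Sum>m\<in>UNIV. g z $ i $ m * christoffel S g z m k j)"
    by (simp add: sum.distrib mult.commute sym[OF assms(1), of j])
  also have "\<dots> = pderiv_on S k (\<lambda>y. g y $ i $ j) z"
    unfolding low psym[of k j i] by (simp add: field_simps)
  finally show ?thesis ..
qed

text \<open>
  In coordinates a one-form with values in the pull-back of the tangent bundle of the target along
  \<open>f\<close> is a matrix-valued function \<open>\<omega>\<close>, with \<open>\<omega> z *v v\<close> the value at the tangent vector \<open>v\<close>. The
  connection induced on such forms is
  \<open>(\<nabla>\<^sub>i \<omega>)\<^sub>j\<^sup>a = \<partial>\<^sub>i \<omega>\<^sub>j\<^sup>a - \<Gamma>(g)\<^sub>i\<^sub>j\<^sup>k \<omega>\<^sub>k\<^sup>a + \<Gamma>(h)\<^sub>b\<^sub>c\<^sup>a(f) \<partial>\<^sub>i f\<^sup>b \<omega>\<^sub>j\<^sup>c\<close>.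
  Here \<open>S\<close> and \<open>T\<close> are the coordinate regions on which the metrics \<open>g\<close> and \<open>h\<close> are given, and \<open>R\<close> is
  the one on which \<open>f\<close> and \<open>\<omega>\<close> are given.
\<close>

definition covariant_deriv ::
    "(real^2) set \<Rightarrow> (real^2 \<Rightarrow> real^2^2) \<Rightarrow> (real^2) set \<Rightarrow> (real^2 \<Rightarrow> real^2^2) \<Rightarrow>
     (real^2) set \<Rightarrow> (real^2 \<Rightarrow> real^2) \<Rightarrow> (real^2 \<Rightarrow> real^2^2) \<Rightarrow> real^2 \<Rightarrow> 2 \<Rightarrow> 2 \<Rightarrow> real^2" where
  "covariant_deriv S g T h R f \<omega> z i j = (\<chi> a.
      pderiv_on R i (\<lambda>y. \<omega> y $ a $ j) z
      - (\<Sum>k\<in>UNIV. christoffel S g z k i j * \<omega> z $ a $ k)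
      + (\<Sum>b\<in>UNIV. \<Sum>c\<in>UNIV. christoffel T h (f z) a b c * pderiv_on R i f z $ b * \<omega> z $ c $ j))"

text \<open>
  \<open>(\<nabla>\<^sub>E \<omega>)(E)\<close> at a point depends only on the value of \<open>E\<close> there, and the sum below does not depend on
  the orthonormal frame.
\<close>

definition codifferential ::
    "(real^2) set \<Rightarrow> (real^2 \<Rightarrow> real^2^2) \<Rightarrow> (real^2) set \<Rightarrow> (real^2 \<Rightarrow> real^2^2) \<Rightarrow>
     (real^2) set \<Rightarrow> (real^2 \<Rightarrow> real^2) \<Rightarrow> (real^2 \<Rightarrow> real^2^2) \<Rightarrow> real^2 \<Rightarrow> real^2" where
  "codifferential S g T h R f \<omega> z =
     (let E = (SOME E. orthonormal_frame (g z) E)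
      in - (\<Sum>m\<in>UNIV. \<Sum>i\<in>UNIV. \<Sum>j\<in>UNIV.
              (E m $ i * E m $ j) *\<^sub>R covariant_deriv S g T h R f \<omega> z i j))"

text \<open>
  The form \<open>dist\<^bsup>p-2\<^esup>(d\<phi>, SO) (d\<phi> - O(d\<phi>))\<close> under the codifferential in the Euler-Lagrange
  equation.
\<close>

definition EL_form ::
    "real \<Rightarrow> 'a surface \<Rightarrow> 'b surface \<Rightarrow> ('a \<Rightarrow> 'b) \<Rightarrow> 'a chart \<Rightarrow> 'b chart \<Rightarrow> real^2 \<Rightarrow> real^2^2" where
  "EL_form p M N \<phi> c d z =
     (let G = metric M c z; H = metric N d (local_rep c d \<phi> z); A = local_differential c d \<phi> z
      in (dist_SO G H A powr (p - 2)) *\<^sub>R (A - polar_factor G H A))"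

text \<open>
  Criticality for \<open>E\<^sub>p\<close> is the classical Euler-Lagrange equation at every point of \<open>M\<close>, for maps \<open>\<phi>\<close>
  of class \<open>C\<^sup>2\<close> with positive Jacobian determinant. The differentiability requirement is what gives
  the equation a meaning. At points where \<open>dist_SO\<close> vanishes, \<open>powr\<close> is \<open>0\<close> even for exponent \<open>0\<close>, but
  there \<open>d\<phi> - O(d\<phi>)\<close> is \<open>0\<close> too, so for \<open>p = 2\<close> the form is always \<open>d\<phi> - O(d\<phi>)\<close>.
\<close>

definition critical_point :: "real \<Rightarrow> 'a surface \<Rightarrow> 'b surface \<Rightarrow> ('a \<Rightarrow> 'b) \<Rightarrow> bool" where
  "critical_point p M N \<phi> \<longleftrightarrow>
     (\<forall>c\<in>charts M. \<forall>d\<in>charts N. EL_form p M N \<phi> c d differentiable_on local_dom c d \<phi> \<and>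
        (\<forall>z\<in>local_dom c d \<phi>.
           codifferential (snd c ` fst c) (metric M c) (snd d ` fst d) (metric N d)
             (local_dom c d \<phi>) (local_rep c d \<phi>) (EL_form p M N \<phi> c d) z = 0))"

end

(*
  Let Cof A be the cofactor map of A with respect to the two metrics: the singular value decomposition
  of A with the two singular values interchanged. In dimension two A + Cof A = (sigma1 + sigma2) O(A), so on K the form A - O(A) equals
  -Cof A and dist(A, SO)^2 = |Cof A|^2 = 1 - 2 J lies in [1/2, 1). The Piola identity
  delta(Cof(d phi)) = 0 gives the case p = 2, and for other p it reduces the Euler-Lagrange equation to
  Cof(d phi)(grad (1 - 2 J)^((p-2)/2)) = 0, that is to dJ = 0. As M is connected, this says that J is
  constant, and J together with sigma1 + sigma2 = 1 determines the singular values.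
*)
theory Submission
  imports Defs
begin

section \<open>Lipschitz regions\<close>

text \<open>In orthonormal frames a matrix is the sum of a conformal part, half of [[m, -n],
  [n, m]], and an anticonformal part; the cofactor map fixes the first and negates the second. So A
  + Cof A is twice the conformal part, which for det A >= 0 is a rotation scaled by sigma1 + sigma2.
  On K the polar factor, nonlinear in general, thus becomes linear in A. The Piola identity is
  proved in coordinates by factoring Cof into a density of the target metric, whose divergence
  cancels the target Christoffel symbols, the cofactors of the Jacobian matrix, which are
  divergence-free because second partials commute, and coclosed one-forms of the source. The
  obstacle is the boundary, where derivatives are only relative to a region. Lipschitz cones have to
  supply their uniqueness, carry the symmetry of second partials over from the interior, and make
  functions with zero derivative locally constant along paths lifted off the boundary.\<close>

lemma dist_self_add: "dist z (z + w) = norm w" for z w :: "'a::real_normed_vector"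
  by (simp add: dist_norm)

text \<open>A Lipschitz graph rises by at most \<open>L * \<bar>s\<bar>\<close> over a horizontal
  distance \<open>\<bar>s\<bar>\<close>, so points steeper than that lie strictly above it, and the
  strict epigraph is open. At interior points any small ball serves, with \<open>L = 0\<close>.
  These cones are the source of all facts about boundary points below.\<close>

lemma lipschitz_region_interior_cone:
  assumes "lipschitz_region S" "z \<in> S"
  obtains u v :: "real^2" and L r :: real where "norm u = 1" "norm v = 1" "u \<bullet> v = 0" "0 \<le> L" "0 < r"
    "\<And>s t. L * \<bar>s\<bar> < t \<Longrightarrow> \<bar>s\<bar> + t < r \<Longrightarrow> z + (s *\<^sub>R u + t *\<^sub>R v) \<in> interior S"
proof (cases "z \<in> interior S")
  case True
  then obtain r where r: "r > 0" "ball z r \<subseteq> interior S"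
    using open_contains_ball open_interior by blast
  show ?thesis
  proof (rule that[of "axis 1 1" "axis 2 1" 0 r])
    fix s t :: real assume st: "0 * \<bar>s\<bar> < t" "\<bar>s\<bar> + t < r"
    have "norm (s *\<^sub>R axis 1 1 + t *\<^sub>R axis 2 1 :: real^2) \<le> \<bar>s\<bar> + \<bar>t\<bar>"
      by (rule norm_triangle_le) simp
    then show "z + (s *\<^sub>R axis 1 1 + t *\<^sub>R axis 2 1) \<in> interior S"
      using st by (intro subsetD[OF r(2)]) (simp add: dist_self_add)
  qed (use r in \<open>auto simp: inner_axis_axis\<close>)
next
  case False
  then obtain r u v and f :: "real \<Rightarrow> real" and L where r: "r > 0"
    and uv: "norm u = 1" "norm v = 1" "u \<bullet> v = 0" and L: "L-lipschitz_on UNIV f"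
    and S: "S \<inter> ball z r = {y \<in> ball z r. f (u \<bullet> y) \<le> v \<bullet> y}"
    using assms unfolding lipschitz_region_def by blast
  have uu: "u \<bullet> u = 1" "v \<bullet> v = 1" "v \<bullet> u = 0"
    using uv by (simp_all add: norm_eq_1 inner_commute)
  have cf: "continuous_on UNIV f" using L lipschitz_on_continuous_on by blast
  have o: "open (ball z r \<inter> {y. f (u \<bullet> y) < v \<bullet> y})"
    by (rule open_Int[OF open_ball open_Collect_less[OF continuous_on_compose2[OF cf]]])
       (auto intro!: continuous_intros)
  have sub: "ball z r \<inter> {y. f (u \<bullet> y) < v \<bullet> y} \<subseteq> interior S"
  proof (rule interior_maximal[OF _ o], rule subsetI)
    fix y assume "y \<in> ball z r \<inter> {y. f (u \<bullet> y) < v \<bullet> y}"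
    then have "y \<in> {y \<in> ball z r. f (u \<bullet> y) \<le> v \<bullet> y}" by simp
    then show "y \<in> S" using S by blast
  qed
  have "z \<in> S \<inter> ball z r" using assms(2) r by simp
  then have z: "f (u \<bullet> z) \<le> v \<bullet> z" unfolding S by simp
  show ?thesis
  proof (rule that[OF uv, of L r])
    fix s t :: real assume st: "L * \<bar>s\<bar> < t" "\<bar>s\<bar> + t < r"
    have "0 \<le> t" using st(1) lipschitz_on_nonneg[OF L] by (smt (verit) mult_nonneg_nonneg)
    have "norm (s *\<^sub>R u + t *\<^sub>R v :: real^2) \<le> \<bar>s\<bar> + \<bar>t\<bar>"
      by (rule norm_triangle_le) (simp add: uv)
    then have b: "z + (s *\<^sub>R u + t *\<^sub>R v) \<in> ball z r"
      using st \<open>0 \<le> t\<close> by (simp add: dist_self_add)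
    have "\<bar>f (u \<bullet> z + s) - f (u \<bullet> z)\<bar> \<le> L * \<bar>s\<bar>"
      using lipschitz_onD[OF L, of "u \<bullet> z + s" "u \<bullet> z"] by (simp add: dist_real_def)
    then have "f (u \<bullet> z + s) < v \<bullet> z + t" using z st by linarith
    then show "z + (s *\<^sub>R u + t *\<^sub>R v) \<in> interior S"
      using b by (intro subsetD[OF sub]) (simp add: inner_add_right uu uv)
  qed (use r lipschitz_on_nonneg[OF L] in auto)
qed

lemma orthonormal_expansion_2:
  fixes u v x :: "real^2"
  assumes "norm u = 1" "norm v = 1" "u \<bullet> v = 0"
  obtains a b where "x = a *\<^sub>R u + b *\<^sub>R v"
proof -
  have nz: "u \<noteq> 0" "v \<noteq> 0" "u \<noteq> v" using assms by (auto simp: norm_eq_1)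
  have "independent {u, v}"
    using assms nz by (intro pairwise_orthogonal_independent)
      (auto simp: pairwise_def orthogonal_def inner_commute)
  then have "UNIV \<subseteq> span {u, v}"
    using nz by (intro card_ge_dim_independent) auto
  then have "x \<in> span {u, v}" by auto
  then obtain k where "x - k *\<^sub>R u \<in> span {v}" by (auto simp: span_breakdown_eq)
  then obtain l where "x - k *\<^sub>R u = l *\<^sub>R v" by (auto simp: span_singleton)
  then have "x = k *\<^sub>R u + l *\<^sub>R v" by (simp add: algebra_simps)
  then show ?thesis by (rule that)
qed

lemma lipschitz_region_openin:
  assumes "lipschitz_region S" "openin (top_of_set S) R"
  shows "lipschitz_region R"
proof -
  obtain T where T: "open T" "R = S \<inter> T" using assms(2) openin_open by blast
  show ?thesis unfolding lipschitz_region_def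
  proof
    fix z assume z: "z \<in> R"
    obtain r0 where r0: "r0 > 0" "ball z r0 \<subseteq> T" using T z open_contains_ball by blast
    show "z \<in> interior R \<or> (\<exists>r>0. \<exists>u v f L. norm u = 1 \<and> norm v = 1 \<and> u \<bullet> v = 0 \<and>
        L-lipschitz_on UNIV f \<and> R \<inter> ball z r = {y \<in> ball z r. (f :: real \<Rightarrow> real) (u \<bullet> y) \<le> v \<bullet> y})"
    proof (cases "z \<in> interior S")
      case True
      then show ?thesis using T z by (simp add: interior_Int interior_open)
    next
      case False
      then obtain r u v and f :: "real \<Rightarrow> real" and L where r: "r > 0"
        and uv: "norm u = 1" "norm v = 1" "u \<bullet> v = 0" "L-lipschitz_on UNIV f"
        and S: "S \<inter> ball z r = {y \<in> ball z r. f (u \<bullet> y) \<le> v \<bullet> y}"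
        using assms z T unfolding lipschitz_region_def by blast
      have sub: "ball z (min r r0) \<subseteq> ball z r" "ball z (min r r0) \<subseteq> T" using r0(2) by auto
      have "R \<inter> ball z (min r r0) = S \<inter> ball z r \<inter> ball z (min r r0)"
        using sub unfolding T(2) by blast
      also have "\<dots> = {y \<in> ball z (min r r0). f (u \<bullet> y) \<le> v \<bullet> y}" unfolding S by auto
      finally have "R \<inter> ball z (min r r0) = {y \<in> ball z (min r r0). f (u \<bullet> y) \<le> v \<bullet> y}" .
      moreover have "min r r0 > 0" using r r0 by simp
      ultimately show ?thesis
        using uv by - (rule disjI2, rule exI[of _ "min r r0"], rule conjI, assumption, rule exI[of _ u],
            rule exI[of _ v], rule exI[of _ f], rule exI[of _ L], intro conjI)
    qed
  qed
qed

text \<open>Composing with the ray \<open>t \<mapsto> z + t *\<^sub>R w\<close> reduces the claim to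
  one variable. A one-sided interval is enough: 0 is a limit point of \<open>{0<..<e}\<close>
  without belonging to it.\<close>

lemma has_derivative_within_unique_direction:
  assumes "(f has_derivative D) (at z within S)" "(f has_derivative D') (at z within S)"
    and "0 < e" "\<And>t. 0 < t \<Longrightarrow> t < e \<Longrightarrow> z + t *\<^sub>R w \<in> S"
  shows "D w = D' w"
proof -
  let ?\<gamma> = "\<lambda>t::real. z + t *\<^sub>R w"
  have g: "(?\<gamma> has_derivative (\<lambda>t. t *\<^sub>R w)) (at 0 within {0<..<e})"
    by (auto intro!: derivative_eq_intros)
  have im: "?\<gamma> ` {0<..<e} \<subseteq> S" using assms(4) by auto
  have 1: "((f \<circ> ?\<gamma>) has_derivative D \<circ> (\<lambda>t. t *\<^sub>R w)) (at 0 within {0<..<e})"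
    by (rule diff_chain_within[OF g], rule has_derivative_subset[OF _ im]) (use assms in simp)
  have 2: "((f \<circ> ?\<gamma>) has_derivative D' \<circ> (\<lambda>t. t *\<^sub>R w)) (at 0 within {0<..<e})"
    by (rule diff_chain_within[OF g], rule has_derivative_subset[OF _ im]) (use assms in simp)
  have "D \<circ> (\<lambda>t. t *\<^sub>R w) = D' \<circ> (\<lambda>t. t *\<^sub>R w)"
  proof (rule frechet_derivative_unique_within[OF 1 2])
    fix i d :: real assume i: "i \<in> Basis" "0 < d"
    then show "\<exists>t. 0 < \<bar>t\<bar> \<and> \<bar>t\<bar> < d \<and> 0 + t *\<^sub>R i \<in> {0<..<e}"
      using assms(3) by (intro exI[of _ "min d e / 2"]) (auto simp: min_def)
  qed
  from fun_cong[OF this, of 1] show ?thesis by simp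
qed

text \<open>The directions \<open>c *\<^sub>R u + v\<close> with small \<open>c\<close> all point
  into the cone, and they span the plane.\<close>

lemma has_derivative_unique_lipschitz_region:
  assumes "lipschitz_region S" "z \<in> S"
    and D: "(f has_derivative D) (at z within S)" "(f has_derivative D') (at z within S)"
  shows "D = D'"
proof
  fix x
  obtain u v L r where uv: "norm u = 1" "norm v = 1" "u \<bullet> v = 0" and "0 \<le> L" "0 < r"
    and c: "\<And>s t. L * \<bar>s\<bar> < t \<Longrightarrow> \<bar>s\<bar> + t < r \<Longrightarrow> z + (s *\<^sub>R u + t *\<^sub>R v) \<in> interior S"
    using lipschitz_region_interior_cone[OF assms(1,2)] by blast
  \<comment> \<open>The first bound on \<open>c\<close> gives \<open>L * \<bar>c\<bar> < 1\<close>,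
    the slope condition of the cone; \<open>\<bar>c\<bar> \<le> 1\<close> with
    \<open>t < r / 2\<close> keeps the point within its truncation.\<close>
  have c': "z + t *\<^sub>R (c *\<^sub>R u + v) \<in> S" if "0 < t" "t < r / 2" "\<bar>c\<bar> * (L + 1) \<le> 1" "\<bar>c\<bar> \<le> 1" for t c
  proof -
    have "L * \<bar>c\<bar> < 1"
    proof (cases "c = 0")
      case False
      then have "\<bar>c\<bar> * L < \<bar>c\<bar> * (L + 1)" by simp
      with that show ?thesis by (simp add: mult.commute)
    qed simp
    then have "t * (L * \<bar>c\<bar>) < t * 1" using that(1) by (intro mult_strict_left_mono)
    then have 1: "L * \<bar>t * c\<bar> < t" using that(1) by (simp add: abs_mult mult.left_commute)
    have "t * \<bar>c\<bar> \<le> t * 1" using that by (intro mult_left_mono) auto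
    moreover have "\<bar>t * c\<bar> = t * \<bar>c\<bar>" using that by (simp add: abs_mult)
    ultimately have 2: "\<bar>t * c\<bar> + t < r" using that by linarith
    show ?thesis using c[OF 1 2] interior_subset by (auto simp: scaleR_right_distrib)
  qed
  have e: "D (c *\<^sub>R u + v) = D' (c *\<^sub>R u + v)" if "\<bar>c\<bar> * (L + 1) \<le> 1" "\<bar>c\<bar> \<le> 1" for c
    by (rule has_derivative_within_unique_direction[OF D, of "r/2"]) (use \<open>0 < r\<close> c' that in auto)
  have lin: "linear D" "linear D'" using D has_derivative_linear by auto
  have v: "D v = D' v" using e[of 0] by simp
  \<comment> \<open>The largest slope that both bounds allow. Its direction together with
    \<open>v\<close>, the case of slope 0, determines the derivative on \<open>u\<close>.\<close>
  define c where "c = 1 / (L + 1)"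
  have c: "c > 0" "D (c *\<^sub>R u + v) = D' (c *\<^sub>R u + v)" using \<open>0 \<le> L\<close> by (auto simp: c_def intro!: e)
  then have "c *\<^sub>R D u = c *\<^sub>R D' u" using v by (simp add: linear_add[OF lin(1)] linear_add[OF lin(2)]
      linear_scale[OF lin(1)] linear_scale[OF lin(2)])
  then have u: "D u = D' u" using c by simp
  obtain a b where "x = a *\<^sub>R u + b *\<^sub>R v" using orthonormal_expansion_2[OF uv] by blast
  then show "D x = D' x" by (simp add: u v linear_add[OF lin(1)] linear_add[OF lin(2)]
      linear_scale[OF lin(1)] linear_scale[OF lin(2)])
qed

lemma frechet_derivative_lipschitz_region:
  assumes "lipschitz_region S" "z \<in> S" "(f has_derivative D) (at z within S)"
  shows "frechet_derivative f (at z within S) = D"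
  by (metis assms differentiableI frechet_derivative_works has_derivative_unique_lipschitz_region)

text \<open>Points on the axis of the cone are interior and approach the apex.\<close>

lemma lipschitz_region_subset_closure_interior:
  assumes "lipschitz_region S"
  shows "S \<subseteq> closure (interior S)"
proof
  fix z assume z: "z \<in> S"
  obtain u v L r where uv: "norm v = 1" and "0 \<le> L" "0 < r"
    and c: "\<And>s t. L * \<bar>s\<bar> < t \<Longrightarrow> \<bar>s\<bar> + t < r \<Longrightarrow> z + (s *\<^sub>R u + t *\<^sub>R v) \<in> interior S"
    using lipschitz_region_interior_cone[OF assms z] by metis
  show "z \<in> closure (interior S)" unfolding closure_approachable
  proof (intro allI impI)
    fix e :: real assume "e > 0"
    let ?t = "min e r / 2"
    have "z + (0 *\<^sub>R u + ?t *\<^sub>R v) \<in> interior S"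
      using \<open>e > 0\<close> \<open>0 < r\<close> by (intro c) (auto simp: min_def)
    moreover have "dist (z + (0 *\<^sub>R u + ?t *\<^sub>R v)) z < e"
      using \<open>e > 0\<close> \<open>0 < r\<close> by (simp add: dist_norm uv min_def)
    ultimately show "\<exists>y\<in>interior S. dist y z < e" by blast
  qed
qed

text \<open>The coincidence set is relatively closed and the interior is dense in the region. This
  carries pointwise identities of continuous functions to the boundary.\<close>

lemma lipschitz_region_eq_if_eq_interior:
  fixes f k :: "real^2 \<Rightarrow> real"
  assumes "lipschitz_region S" "continuous_on S f" "continuous_on S k"
    and "\<And>y. y \<in> interior S \<Longrightarrow> f y = k y" and "z \<in> S"
  shows "f z = k z"
proof -
  have "closedin (top_of_set S) {x \<in> S. f x - k x = 0}"
    using continuous_closedin_preimage_constant[of S "\<lambda>x. f x - k x" 0] assms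
    by (auto intro: continuous_on_diff)
  then obtain C where C: "closed C" "{x \<in> S. f x - k x = 0} = S \<inter> C"
    unfolding closedin_closed by blast
  have "interior S \<subseteq> C" using C(2) assms(4) interior_subset[of S] by auto
  then have "closure (interior S) \<subseteq> C" using C(1) closure_minimal by blast
  then have "z \<in> S \<inter> C" using lipschitz_region_subset_closure_interior[OF assms(1)] assms(5) by blast
  then show ?thesis using C(2) by auto
qed

text \<open>A function with zero derivative is constant along every segment in \<open>S\<close>.
  Near a boundary point the segment from \<open>y\<close> to \<open>z\<close> may leave
  \<open>S\<close>, so it is replaced by three: up from \<open>y\<close> along \<open>v\<close>,
  across at a safe height, and down to \<open>z\<close>.\<close>

lemma lipschitz_region_locally_constant:
  fixes f :: "real^2 \<Rightarrow> real"
  assumes S: "lipschitz_region S" and z: "z \<in> S"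
    and d: "\<And>y. y \<in> S \<Longrightarrow> (f has_derivative (\<lambda>_. 0)) (at y within S)"
  obtains e where "e > 0" "\<And>y. y \<in> S \<Longrightarrow> dist z y < e \<Longrightarrow> f y = f z"
proof -
  have seg: "f a = f b" if ab: "closed_segment a b \<subseteq> S" for a b
  proof -
    have "\<exists>c. \<forall>x\<in>closed_segment a b. f x = c"
      by (rule has_derivative_zero_constant) (use ab d has_derivative_subset in \<open>blast+\<close>)
    then show ?thesis by (metis ends_in_segment)
  qed
  show ?thesis
  proof (cases "z \<in> interior S")
    case True
    then obtain r where r: "r > 0" "ball z r \<subseteq> S" using mem_interior by blast
    show ?thesis
    proof (rule that[OF r(1)])
      fix y assume "y \<in> S" "dist z y < r"
      then have "closed_segment y z \<subseteq> ball z r" by (intro closed_segment_subset) (use r in auto)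
      then show "f y = f z" using seg r by blast
    qed
  next
    case False
    then obtain r u v and \<rho> :: "real \<Rightarrow> real" and L where r: "r > 0"
      and uv: "norm u = 1" "norm v = 1" "u \<bullet> v = 0" and L: "L-lipschitz_on UNIV \<rho>"
      and S': "S \<inter> ball z r = {y \<in> ball z r. \<rho> (u \<bullet> y) \<le> v \<bullet> y}"
      using assms unfolding lipschitz_region_def by blast
    have uu: "u \<bullet> u = 1" "v \<bullet> v = 1" "v \<bullet> u = 0"
      using uv by (simp_all add: norm_eq_1 inner_commute)
    have L0: "0 \<le> L" using lipschitz_on_nonneg[OF L] .
    have inS: "y \<in> S" if "dist z y < r" "\<rho> (u \<bullet> y) \<le> v \<bullet> y" for y
    proof -
      have "y \<in> {y \<in> ball z r. \<rho> (u \<bullet> y) \<le> v \<bullet> y}" using that by simp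
      then show ?thesis using S' by blast
    qed
    have Sin0: "S \<inter> ball z r \<subseteq> {y. \<rho> (u \<bullet> y) \<le> v \<bullet> y}" using S' by blast
    have Sin: "\<rho> (u \<bullet> y) \<le> v \<bullet> y" if "dist z y < r" "y \<in> S" for y
      using subsetD[OF Sin0, of y] that by simp
    \<comment> \<open>On the middle segment the graph can gain \<open>L * e\<close> and the starting
      height can lose \<open>e\<close>, so a lift by \<open>h = (L + 1) * e\<close> clears the
      graph. The path stays within distance \<open>h + e = (L + 2) * e\<close> of \<open>z\<close>,
      which is less than \<open>r\<close>.\<close>
    define e where "e = r / (L + 3)"
    have e: "e > 0" "(L + 3) * e = r" using r L0 by (auto simp: e_def)
    moreover have "(L + 1) * e + e = (L + 3) * e - e" "0 \<le> L * e"
      using L0 e by (simp_all add: algebra_simps)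
    ultimately have er: "(L + 1) * e + e < r" "e < r" "L * e \<ge> 0"
      by (simp_all add: distrib_right)
    show ?thesis
    proof (rule that[OF e(1)])
      fix y assume y: "y \<in> S" "dist z y < e"
      define h where "h = (L + 1) * e"
      have h: "h \<ge> 0" "h + e < r" using er e L0 by (auto simp: h_def)
      have dz: "dist z z < e" using e by simp
      have up: "closed_segment w (w + h *\<^sub>R v) \<subseteq> S" if w: "w \<in> S" "dist z w < e" for w
      proof
        fix x assume "x \<in> closed_segment w (w + h *\<^sub>R v)"
        then obtain t where t: "0 \<le> t" "t \<le> 1" "x = w + (t * h) *\<^sub>R v"
          by (auto simp: in_segment algebra_simps)
        have th: "0 \<le> t * h" "t * h \<le> h" using t h mult_right_mono[of t 1 h] by auto
        show "x \<in> S"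
        proof (rule inS)
          have "dist z x \<le> dist z w + dist w x" by (rule dist_triangle)
          also have "dist w x = t * h" using th t by (simp add: dist_norm uv)
          finally show "dist z x < r" using th w h by linarith
          show "\<rho> (u \<bullet> x) \<le> v \<bullet> x"
            using Sin[of w] w th er by (simp add: t inner_add_right uu uv)
        qed
      qed
      have "closed_segment (y + h *\<^sub>R v) (z + h *\<^sub>R v) \<subseteq> S"
      proof
        fix x assume "x \<in> closed_segment (y + h *\<^sub>R v) (z + h *\<^sub>R v)"
        then obtain t where t: "0 \<le> t" "t \<le> 1"
          "x = (1 - t) *\<^sub>R (y + h *\<^sub>R v) + t *\<^sub>R (z + h *\<^sub>R v)"
          by (auto simp: in_segment)
        then have x: "x = (z + (1 - t) *\<^sub>R (y - z)) + h *\<^sub>R v" by (simp add: algebra_simps)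
        define w where "w = (1 - t) *\<^sub>R (y - z)"
        have nw: "norm w < e"
        proof -
          have "norm w = (1 - t) * norm (y - z)" using t by (simp add: w_def)
          also have "\<dots> \<le> 1 * norm (y - z)" using t by (intro mult_right_mono) auto
          finally show ?thesis using y by (simp add: dist_norm norm_minus_commute)
        qed
        have x: "x = z + w + h *\<^sub>R v" using x by (simp add: w_def)
        have uw: "\<bar>u \<bullet> w\<bar> < e" "\<bar>v \<bullet> w\<bar> < e"
          using Cauchy_Schwarz_ineq2[of u w] Cauchy_Schwarz_ineq2[of v w] nw uv by auto
        show "x \<in> S"
        proof (rule inS)
          have "dist z x \<le> norm w + norm (h *\<^sub>R v)"
            unfolding x add.assoc dist_self_add by (rule norm_triangle_ineq)
          then show "dist z x < r" using nw h uv by simp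
          have "\<bar>\<rho> (u \<bullet> z + u \<bullet> w) - \<rho> (u \<bullet> z)\<bar> \<le> L * \<bar>u \<bullet> w\<bar>"
            using lipschitz_onD[OF L, of "u \<bullet> z + u \<bullet> w" "u \<bullet> z"] by (simp add: dist_real_def)
          also have "\<dots> \<le> L * e" using L0 uw by (intro mult_left_mono) auto
          finally have "\<rho> (u \<bullet> z + u \<bullet> w) \<le> \<rho> (u \<bullet> z) + L * e" by linarith
          also have "\<dots> \<le> v \<bullet> z + L * e" using Sin[of z] z r by simp
          finally show "\<rho> (u \<bullet> x) \<le> v \<bullet> x"
            using uw unfolding x h_def by (simp add: inner_add_right uu uv algebra_simps)
        qed
      qed
      then show "f y = f z" using seg[OF up[OF y]] seg[OF up[OF z dz]] seg by simp
    qed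
  qed
qed

section \<open>Linear algebra of the set K\<close>

text \<open>The adjugate matrix: \<open>det A\<close> times the inverse, in a form that is linear in
  \<open>A\<close> and needs no invertibility.\<close>

definition adj2 :: "real^2^2 \<Rightarrow> real^2^2" where
  "adj2 A = vector [vector [A $ 2 $ 2, - A $ 1 $ 2], vector [- A $ 2 $ 1, A $ 1 $ 1]]"

lemma adj2_component [simp]:
  "adj2 A $ 1 $ 1 = A $ 2 $ 2" "adj2 A $ 1 $ 2 = - A $ 1 $ 2"
  "adj2 A $ 2 $ 1 = - A $ 2 $ 1" "adj2 A $ 2 $ 2 = A $ 1 $ 1"
  by (simp_all add: adj2_def)

lemma matrix_eq_2: "A = B \<longleftrightarrow> A $ 1 $ 1 = B $ 1 $ 1 \<and> A $ 1 $ 2 = B $ 1 $ 2 \<and>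
    A $ 2 $ 1 = B $ 2 $ 1 \<and> A $ 2 $ 2 = B $ 2 $ 2" for A B :: "'a^2^2"
  by (auto simp: vec_eq_iff forall_2)

lemma matrix_mult_component_2: "(A ** B) $ i $ j = A $ i $ 1 * B $ 1 $ j + A $ i $ 2 * B $ 2 $ j"
  for A B :: "real^2^2"
  by (simp add: matrix_matrix_mult_def sum_2)

lemma transpose_component [simp]: "transpose A $ i $ j = A $ j $ i"
  by (simp add: transpose_def)

lemma mat_1_component_2 [simp]: "(mat 1 :: real^2^2) $ 1 $ 1 = 1" "(mat 1 :: real^2^2) $ 1 $ 2 = 0"
  "(mat 1 :: real^2^2) $ 2 $ 1 = 0" "(mat 1 :: real^2^2) $ 2 $ 2 = 1"
  by (simp_all add: mat_def)

lemma matrix_inv_eqI: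
  fixes A B :: "real^'n^'n"
  assumes "A ** B = mat 1"
  shows "matrix_inv A = B"
proof -
  have "B ** A = mat 1" using assms matrix_left_right_inverse by blast
  with assms have "\<exists>A'. A ** A' = mat 1 \<and> A' ** A = mat 1" by blast
  then have "A ** matrix_inv A = mat 1 \<and> matrix_inv A ** A = mat 1"
    unfolding matrix_inv_def by (rule someI_ex)
  then show ?thesis using \<open>B ** A = mat 1\<close>
    by (metis matrix_mul_assoc matrix_mul_lid matrix_mul_rid)
qed

lemma matrix_mult_scaleR_2: "A ** (c *\<^sub>R B) = c *\<^sub>R (A ** B)" "(c *\<^sub>R A) ** B = c *\<^sub>R (A ** B)"
  for A B :: "real^2^2"
  by (simp_all add: matrix_eq_2 matrix_mult_component_2 algebra_simps)

lemma matrix_mult_adj2: "A ** adj2 A = det A *\<^sub>R mat 1" "adj2 A ** A = det A *\<^sub>R mat 1"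
  by (simp_all add: matrix_eq_2 matrix_mult_component_2 det_2 algebra_simps)

lemma matrix_inv_2:
  fixes A :: "real^2^2"
  assumes "det A \<noteq> 0"
  shows "matrix_inv A = (1 / det A) *\<^sub>R adj2 A"
  by (rule matrix_inv_eqI) (use assms in \<open>simp add: matrix_mult_scaleR_2 matrix_mult_adj2\<close>)

lemma gram_matrix_pos:
  assumes "gram_matrix G"
  shows "G $ 1 $ 1 > 0" "det G > 0" "G $ 2 $ 1 = G $ 1 $ 2"
proof -
  show s: "G $ 2 $ 1 = G $ 1 $ 2" using gram_matrix_sym[OF assms] .
  have pos: "x * (G $ 1 $ 1 * x + G $ 1 $ 2 * y) + y * (G $ 1 $ 2 * x + G $ 2 $ 2 * y) > 0"
    if "x \<noteq> 0 \<or> y \<noteq> 0" for x y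
  proof -
    have "(vector [x, y] :: real^2) \<noteq> 0" using that by (auto simp: vec_eq_iff forall_2)
    then have "(vector [x, y] :: real^2) \<bullet> (G *v vector [x, y]) > 0"
      using assms unfolding gram_matrix_def by blast
    then show ?thesis by (simp add: inner_vec_def sum_2 matrix_vector_mult_def s)
  qed
  show p: "G $ 1 $ 1 > 0" using pos[of 1 0] by simp
  \<comment> \<open>The test vector is orthogonal to the first basis vector with respect to
    \<open>G\<close>, and its square length is exactly this product.\<close>
  have "G $ 1 $ 1 * det G > 0" using pos[of "- G $ 1 $ 2" "G $ 1 $ 1"] p
    by (simp add: det_2 s algebra_simps)
  then show "det G > 0" using p by (simp add: zero_less_mult_iff)
qed

text \<open>The columns of \<open>P\<close> are a positively oriented orthonormal basis for \<open>G\<close>, and \<open>P'\<close> is its inverse.\<close>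

definition metric_frame :: "real^2^2 \<Rightarrow> real^2^2 \<Rightarrow> real^2^2 \<Rightarrow> bool" where
  "metric_frame G P P' \<longleftrightarrow> P ** P' = mat 1 \<and> P' ** P = mat 1 \<and> matrix_inv G = P ** transpose P \<and>
     G = transpose P' ** P' \<and> det P = 1 / sqrt (det G) \<and> det P' = sqrt (det G)"

lemma metric_frameD:
  assumes "metric_frame G P P'"
  shows "P ** P' = mat 1" "P' ** P = mat 1" "matrix_inv G = P ** transpose P"
    "G = transpose P' ** P'" "det P = 1 / sqrt (det G)" "det P' = sqrt (det G)"
  using assms unfolding metric_frame_def by blast+

text \<open>\<open>P'\<close> is the Cholesky factor of \<open>G\<close>, and the columns of its
  inverse \<open>P\<close> come from applying Gram-Schmidt to the coordinate basis. Positive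
  diagonal entries give the orientation.\<close>

lemma metric_frame_exists:
  assumes G: "gram_matrix G"
  obtains P P' where "metric_frame G P P'"
proof -
  note g = gram_matrix_pos[OF G]
  define d where "d = sqrt (det G)"
  define e where "e = sqrt (G $ 1 $ 1)"
  have d: "d > 0" "d * d = det G" and e: "e > 0" "e * e = G $ 1 $ 1"
    using g by (auto simp: d_def e_def)
  have G22: "G $ 2 $ 2 = (d * d + G $ 1 $ 2 * G $ 1 $ 2) / (e * e)"
    using g unfolding d(2) e(2) by (simp add: det_2 field_simps)
  define P :: "real^2^2" where "P = vector [vector [1 / e, - G $ 1 $ 2 / (e * d)], vector [0, e / d]]"
  define P' :: "real^2^2" where "P' = vector [vector [e, G $ 1 $ 2 / e], vector [0, d / e]]"
  have 1: "P ** P' = mat 1" "P' ** P = mat 1"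
    using d e by (auto simp: P_def P'_def matrix_eq_2 matrix_mult_component_2 field_simps)
  have 2: "G = transpose P' ** P'"
    using e(1) d(1) g(3) by (auto simp: P'_def matrix_eq_2 matrix_mult_component_2 e(2)[symmetric] G22 field_simps)
  have "G ** (P ** transpose P) = transpose P' ** (P' ** P) ** transpose P"
    unfolding 2 by (simp add: matrix_mul_assoc)
  also have "\<dots> = transpose (P ** P')" unfolding matrix_transpose_mul by (simp add: 1)
  finally have 3: "matrix_inv G = P ** transpose P" by (intro matrix_inv_eqI) (simp add: 1)
  have "det P = 1 / d" "det P' = d" using d e by (auto simp: P_def P'_def det_2)
  with 1 2 3 show ?thesis by (intro that[of P P']) (auto simp: metric_frame_def d_def)
qed

section \<open>Reduction of metric notions to orthonormal frames\<close>

lemma orthonormal_frame_exists: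
  assumes "gram_matrix G"
  shows "\<exists>E. orthonormal_frame G E"
proof -
  obtain P P' where P: "metric_frame G P P'" using metric_frame_exists[OF assms] .
  have "transpose P ** G ** P = transpose (P' ** P) ** (P' ** P)"
    by (subst metric_frameD(4)[OF P]) (simp add: matrix_mul_assoc matrix_transpose_mul)
  then have "transpose P ** G ** P = mat 1" by (simp add: metric_frameD(2)[OF P])
  then have c: "(transpose P ** G ** P) $ i $ j = (if i = j then 1 else 0)" for i j
    by (simp add: mat_def)
  have "orthonormal_frame G (\<lambda>m. \<chi> i. P $ i $ m)"
    unfolding orthonormal_frame_def c[symmetric]
    by (simp add: inner_vec_def sum_2 matrix_vector_mult_def matrix_mult_component_2 algebra_simps)
  then show ?thesis by blast
qed

text \<open>If the columns of \<open>P\<close> are orthonormal, then \<open>transpose P ** G\<close>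
  is a left inverse of \<open>P\<close>, hence also a right inverse. The result no longer mentions
  the frame, so the choice made in \<open>codifferential\<close> is harmless.\<close>

lemma orthonormal_frame_sum_2:
  assumes "gram_matrix G" "orthonormal_frame G E"
  shows "(\<Sum>m\<in>UNIV. E m $ i * E m $ j) = matrix_inv G $ i $ j"
proof -
  define P :: "real^2^2" where "P = (\<chi> i m. E m $ i)"
  have "(transpose P ** G ** P) $ i $ j = E i \<bullet> (G *v E j)" for i j
    by (simp add: P_def inner_vec_def sum_2 matrix_vector_mult_def matrix_mult_component_2 algebra_simps)
  then have "transpose P ** G ** P = mat 1"
    using assms(2) by (simp add: vec_eq_iff orthonormal_frame_def mat_def)
  then have "P ** (transpose P ** G) = mat 1" using matrix_left_right_inverse by blast
  then have "(P ** transpose P) ** G = mat 1" by (simp add: matrix_mul_assoc)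
  then have "G ** (P ** transpose P) = mat 1" using matrix_left_right_inverse by blast
  then have "matrix_inv G = P ** transpose P" by (rule matrix_inv_eqI)
  then show ?thesis by (simp add: matrix_mult_component_2 sum_2 P_def)
qed

text \<open>In orthonormal frames the adjoint is the transpose. The composite
  \<open>A\<^sup>* A\<close> is therefore conjugate to \<open>transpose B ** B\<close>, so trace and
  eigenvalues can be read off from \<open>B\<close>.\<close>

lemma adjoint_map_frame:
  fixes A :: "real^2^2"
  assumes P: "metric_frame G P P'" and Q: "metric_frame H Q Q'"
  defines "B \<equiv> Q' ** A ** P"
  shows "adjoint_map G H A ** A = P ** (transpose B ** B) ** P'"
proof -
  have B: "P ** (transpose B ** B) ** P' =
      (P ** transpose P) ** transpose A ** (transpose Q' ** Q') ** A ** (P ** P')"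
    by (simp add: B_def matrix_transpose_mul matrix_mul_assoc)
  have e: "P ** P' = mat 1" "matrix_inv G = P ** transpose P" "H = transpose Q' ** Q'"
    using metric_frameD[OF P] metric_frameD[OF Q] by blast+
  show ?thesis unfolding B by (simp only: adjoint_map_def e matrix_mul_rid)
qed

lemma hom_norm_frame:
  fixes A :: "real^2^2"
  assumes P: "metric_frame G P P'" and Q: "metric_frame H Q Q'"
  defines "B \<equiv> Q' ** A ** P"
  shows "hom_norm G H A =
    sqrt ((B $ 1 $ 1)\<^sup>2 + (B $ 1 $ 2)\<^sup>2 + (B $ 2 $ 1)\<^sup>2 + (B $ 2 $ 2)\<^sup>2)"
proof -
  have "trace (adjoint_map G H A ** A) = trace (P' ** (P ** (transpose B ** B)))"
    unfolding adjoint_map_frame[OF P Q] B_def by (rule trace_mul_sym)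
  also have "\<dots> = trace (transpose B ** B)"
    by (simp add: metric_frameD[OF P] matrix_mul_assoc)
  finally show ?thesis unfolding hom_norm_def
    by (simp add: trace_def sum_2 matrix_mult_component_2 power2_eq_square algebra_simps)
qed

lemma metric_det_frame:
  assumes P: "metric_frame G P P'" and Q: "metric_frame H Q Q'"
  shows "metric_det G H A = det (Q' ** A ** P)"
  by (simp add: metric_det_def det_mul metric_frameD(5)[OF P] metric_frameD(6)[OF Q])

text \<open>In orthonormal frames the orientation-preserving isometries are the rotation matrices,
  parametrized by their first column.\<close>

lemma SO_set_frame:
  fixes A :: "real^2^2"
  assumes P: "metric_frame G P P'" and Q: "metric_frame H Q Q'" and "gram_matrix G" "gram_matrix H"
  defines "B \<equiv> Q' ** A ** P"
  shows "A \<in> SO_set G H \<longleftrightarrow>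
    B $ 2 $ 2 = B $ 1 $ 1 \<and> B $ 1 $ 2 = - B $ 2 $ 1 \<and> (B $ 1 $ 1)\<^sup>2 + (B $ 2 $ 1)\<^sup>2 = 1"
proof -
  have pos: "det Q' > 0" "det P > 0" using gram_matrix_pos[OF assms(3)] gram_matrix_pos[OF assms(4)]
    by (simp_all add: metric_frameD(5)[OF P] metric_frameD(6)[OF Q])
  have det: "det B > 0 \<longleftrightarrow> det A > 0"
    using pos by (simp add: B_def det_mul zero_less_mult_iff)
  have "(\<forall>v w. (A *v v) \<bullet> (H *v (A *v w)) = v \<bullet> (G *v w)) \<longleftrightarrow> transpose A ** H ** A = G"
  proof
    assume l: "\<forall>v w. (A *v v) \<bullet> (H *v (A *v w)) = v \<bullet> (G *v w)"
    have "(transpose A ** H ** A) *v w = G *v w" for w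
    proof (rule vector_eq_ldot[THEN iffD1], rule allI)
      fix v
      have "v \<bullet> ((transpose A ** H ** A) *v w) = (A *v v) \<bullet> (H *v (A *v w))"
        by (simp add: inner_vec_def sum_2 matrix_vector_mult_def matrix_mult_component_2 algebra_simps)
      then show "v \<bullet> ((transpose A ** H ** A) *v w) = v \<bullet> (G *v w)" using l by simp
    qed
    then show "transpose A ** H ** A = G" by (simp add: matrix_eq)
  next
    assume r: "transpose A ** H ** A = G"
    show "\<forall>v w. (A *v v) \<bullet> (H *v (A *v w)) = v \<bullet> (G *v w)"
      unfolding r[symmetric]
      by (simp add: inner_vec_def sum_2 matrix_vector_mult_def matrix_mult_component_2 algebra_simps)
  qed
  also have "\<dots> \<longleftrightarrow> transpose B ** B = mat 1"
  proof -
    have B: "transpose B ** B = transpose P ** (transpose A ** H ** A) ** P"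
      by (subst metric_frameD(4)[OF Q]) (simp add: B_def matrix_transpose_mul matrix_mul_assoc)
    have G: "transpose P ** G ** P = mat 1"
    proof -
      have "transpose P ** G ** P = transpose (P' ** P) ** (P' ** P)"
        by (subst metric_frameD(4)[OF P]) (simp add: matrix_mul_assoc matrix_transpose_mul)
      then show ?thesis by (simp add: metric_frameD(2)[OF P])
    qed
    have "transpose P' ** (transpose P ** X ** P) ** P' = X" for X
    proof -
      have "transpose P' ** (transpose P ** X ** P) ** P' = transpose (P ** P') ** X ** (P ** P')"
        by (simp add: matrix_transpose_mul matrix_mul_assoc)
      then show ?thesis by (simp add: metric_frameD(1)[OF P])
    qed
    then show ?thesis unfolding B using G by metis
  qed
  finally have "A \<in> SO_set G H \<longleftrightarrow> det B > 0 \<and> transpose B ** B = mat 1"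
    by (simp add: SO_set_def det)
  also have "\<dots> \<longleftrightarrow> B $ 2 $ 2 = B $ 1 $ 1 \<and> B $ 1 $ 2 = - B $ 2 $ 1 \<and> (B $ 1 $ 1)\<^sup>2 + (B $ 2 $ 1)\<^sup>2 = 1"
    (is "?L \<longleftrightarrow> ?R")
  proof
    assume L: ?L
    define a b c d where "a = B $ 1 $ 1" and "b = B $ 1 $ 2" and "c = B $ 2 $ 1" and "d = B $ 2 $ 2"
    have e: "a*a + c*c = 1" "a*b + c*d = 0" "b*b + d*d = 1" and p: "a*d - b*c > 0"
      using L by (auto simp: matrix_eq_2 matrix_mult_component_2 det_2 a_def b_def c_def d_def)
    have "(a*d - b*c)\<^sup>2 = (a*a + c*c) * (b*b + d*d) - (a*b + c*d)\<^sup>2"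
      by (simp add: power2_eq_square algebra_simps)
    then have "(a*d - b*c)\<^sup>2 = 1" using e by simp
    then have "a*d - b*c = 1" using p by (simp add: power2_eq_1_iff)
    \<comment> \<open>The left side is the sum of the squares of all entries minus twice the
      determinant, that is 2 - 2.\<close>
    then have "(a - d)\<^sup>2 + (b + c)\<^sup>2 = 0"
      using e by (simp add: power2_eq_square algebra_simps)
    then show ?R using e by (simp add: a_def b_def c_def d_def sum_power2_eq_zero_iff power2_eq_square)
  next
    assume ?R then show ?L
      by (auto simp: matrix_eq_2 matrix_mult_component_2 det_2 power2_eq_square algebra_simps)
  qed
  finally show ?thesis .
qed

text \<open>The quadratic is the characteristic polynomial of \<open>transpose B ** B\<close>, whose
  trace is \<open>t\<close> and whose determinant is the square of \<open>det B\<close>.\<close>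

lemma gram_eigenvalues_frame:
  fixes A :: "real^2^2"
  assumes P: "metric_frame G P P'" and Q: "metric_frame H Q Q'"
  defines "B \<equiv> Q' ** A ** P"
  defines "t \<equiv> (B $ 1 $ 1)\<^sup>2 + (B $ 1 $ 2)\<^sup>2 + (B $ 2 $ 1)\<^sup>2 + (B $ 2 $ 2)\<^sup>2"
  shows "gram_eigenvalues G H A = {l. l * l - t * l + (det B)\<^sup>2 = 0}"
proof -
  let ?C = "adjoint_map G H A ** A"
  have "(\<exists>v. v \<noteq> 0 \<and> ?C *v v = l *\<^sub>R v) \<longleftrightarrow> det (transpose B ** B - mat l) = 0" for l
  proof -
    have "C *v v = l *\<^sub>R v \<longleftrightarrow> (C - mat l) *v v = 0" for v and C :: "real^2^2"
      by (simp add: vec_eq_iff forall_2 sum_2 mat_def matrix_vector_mult_def left_diff_distrib)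
        linarith
    then have "(\<exists>v. v \<noteq> 0 \<and> ?C *v v = l *\<^sub>R v) \<longleftrightarrow> \<not> invertible (?C - mat l)"
      unfolding invertible_left_inverse matrix_left_invertible_ker by blast
    also have "\<dots> \<longleftrightarrow> det (?C - mat l) = 0" by (simp add: invertible_det_nz)
    also have "?C - mat l = P ** (transpose B ** B - mat l) ** P'"
    proof -
      have "P ** mat l ** P' = mat l"
      proof -
        have "P ** mat l = mat l ** P" by (simp add: matrix_eq_2 matrix_mult_component_2 mat_def)
        then have "P ** mat l ** P' = mat l ** (P ** P')" by (simp add: matrix_mul_assoc)
        then show ?thesis by (simp add: metric_frameD(1)[OF P])
      qed
      moreover have "P ** (X - Y) ** P' = P ** X ** P' - P ** Y ** P'" for X Y
        by (simp add: matrix_eq_2 matrix_mult_component_2 algebra_simps)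
      ultimately show ?thesis using adjoint_map_frame[OF P Q, of A] by (simp add: B_def)
    qed
    also have "det (P ** (transpose B ** B - mat l) ** P') = det (transpose B ** B - mat l) * det (P ** P')"
      by (simp only: det_mul mult_ac)
    also have "\<dots> = det (transpose B ** B - mat l)" by (simp add: metric_frameD(1)[OF P])
    finally show ?thesis .
  qed
  moreover have "det (transpose B ** B - mat l) = l * l - t * l + (det B)\<^sup>2" for l
    by (simp add: det_2 matrix_mult_component_2 mat_def t_def power2_eq_square algebra_simps)
  ultimately show ?thesis unfolding gram_eigenvalues_def by simp
qed

text \<open>Vieta's formulas for the characteristic polynomial of \<open>A\<^sup>* A\<close>. The
  sign hypothesis removes the absolute value when the square root of the squared determinant is
  taken.\<close>

lemma singular_values:
  assumes G: "gram_matrix G" and H: "gram_matrix H" and pos: "metric_det G H A \<ge> 0"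
  shows "sigma1 G H A * sigma2 G H A = metric_det G H A"
    and "(sigma1 G H A)\<^sup>2 + (sigma2 G H A)\<^sup>2 = (hom_norm G H A)\<^sup>2"
    and "0 \<le> sigma2 G H A" "sigma2 G H A \<le> sigma1 G H A"
proof -
  obtain P P' where P: "metric_frame G P P'" using metric_frame_exists[OF G] .
  obtain Q Q' where Q: "metric_frame H Q Q'" using metric_frame_exists[OF H] .
  define B where "B = Q' ** A ** P"
  define t where "t = (B $ 1 $ 1)\<^sup>2 + (B $ 1 $ 2)\<^sup>2 + (B $ 2 $ 1)\<^sup>2 + (B $ 2 $ 2)\<^sup>2"
  define D where "D = t\<^sup>2 - 4 * (det B)\<^sup>2"
  have t: "t \<ge> 0" by (simp add: t_def)
  \<comment> \<open>The discriminant factors as \<open>(t + 2 * det B) * (t - 2 * det B)\<close>; up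
    to a factor 2 these are the squared norms of the doubled conformal and anticonformal parts of
    \<open>B\<close>.\<close>
  have "D = ((B $ 1 $ 1 + B $ 2 $ 2)\<^sup>2 + (B $ 1 $ 2 - B $ 2 $ 1)\<^sup>2) *
      ((B $ 1 $ 1 - B $ 2 $ 2)\<^sup>2 + (B $ 1 $ 2 + B $ 2 $ 1)\<^sup>2)"
    by (simp add: D_def t_def det_2 power2_eq_square algebra_simps)
  then have D: "D \<ge> 0" by simp
  define p q where "p = (t + sqrt D) / 2" and "q = (t - sqrt D) / 2"
  have pq: "p + q = t" "p * q = (det B)\<^sup>2"
    using D by (auto simp: p_def q_def field_simps D_def power2_eq_square simp flip: real_sqrt_mult)
  have "sqrt D \<le> sqrt (t\<^sup>2)" unfolding real_sqrt_le_iff by (simp add: D_def)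
  then have q: "0 \<le> q" "q \<le> p" using t D by (auto simp: p_def q_def)
  have "gram_eigenvalues G H A = {p, q}"
  proof -
    have "l * l - t * l + (det B)\<^sup>2 = (l - p) * (l - q)" for l
      unfolding pq[symmetric] by (simp add: algebra_simps)
    then show ?thesis unfolding gram_eigenvalues_frame[OF P Q, of A, folded B_def, folded t_def] by auto
  qed
  then have s: "sigma1 G H A = sqrt p" "sigma2 G H A = sqrt q"
    using q by (simp_all add: sigma1_def sigma2_def max_def min_def)
  have dB: "metric_det G H A = det B" unfolding B_def by (rule metric_det_frame[OF P Q])
  show "sigma1 G H A * sigma2 G H A = metric_det G H A"
    using pos by (simp add: s dB pq flip: real_sqrt_mult)
  show "(sigma1 G H A)\<^sup>2 + (sigma2 G H A)\<^sup>2 = (hom_norm G H A)\<^sup>2"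
    using q t pq(1) by (simp add: s hom_norm_frame[OF P Q, of A, folded B_def, folded t_def])
  show "0 \<le> sigma2 G H A" "sigma2 G H A \<le> sigma1 G H A" using q by (simp_all add: s)
qed

text \<open>
  In invariant terms \<open>metric_det G H A\<close> times the inverse of the adjoint of \<open>A\<close>; the adjugate
  matrices make it linear in \<open>A\<close>.
\<close>

definition metric_cofactor :: "real^2^2 \<Rightarrow> real^2^2 \<Rightarrow> real^2^2 \<Rightarrow> real^2^2" where
  "metric_cofactor G H A =
     (1 / (sqrt (det G) * sqrt (det H))) *\<^sub>R (adj2 H ** transpose (adj2 A) ** G)"

lemma adj2_mult: "adj2 (A ** B) = adj2 B ** adj2 A"
  by (simp add: matrix_eq_2 matrix_mult_component_2 algebra_simps)

lemma adj2_eq_inverse: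
  assumes "P ** P' = mat 1"
  shows "adj2 P = det P *\<^sub>R P'"
proof -
  have "adj2 P ** P ** P' = det P *\<^sub>R P'"
    by (simp add: matrix_mult_adj2 matrix_mult_scaleR_2)
  then show ?thesis using assms by (simp add: matrix_mul_assoc[symmetric])
qed

text \<open>This identifies the definition as the ordinary cofactor matrix seen in orthonormal
  frames: its scalar factor is the one that compensates the determinants of the two frames.\<close>

lemma metric_cofactor_frame:
  assumes P: "metric_frame G P P'" and Q: "metric_frame H Q Q'" and G: "gram_matrix G" and H: "gram_matrix H"
  shows "Q' ** metric_cofactor G H A ** P = transpose (adj2 (Q' ** A ** P))"
proof -
  have pos: "det G > 0" "det H > 0" using gram_matrix_pos G H by auto
  have aQ: "adj2 Q' = sqrt (det H) *\<^sub>R Q" using adj2_eq_inverse[OF metric_frameD(2)[OF Q]] by (simp add: metric_frameD(6)[OF Q])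
  have aP: "adj2 P = (1 / sqrt (det G)) *\<^sub>R P'" using adj2_eq_inverse[OF metric_frameD(1)[OF P]] by (simp add: metric_frameD(5)[OF P])
  have "adj2 H = det H *\<^sub>R matrix_inv H" using pos by (simp add: matrix_inv_2)
  then have aH: "adj2 H = det H *\<^sub>R (Q ** transpose Q)" by (simp add: metric_frameD(3)[OF Q])
  note sc = matrix_mult_scaleR_2
  have tr: "transpose (c *\<^sub>R X) = c *\<^sub>R transpose X" for c and X :: "real^2^2"
    by (simp add: matrix_eq_2)
  have "Q' ** metric_cofactor G H A ** P = (det H / (sqrt (det G) * sqrt (det H))) *\<^sub>R
      ((Q' ** Q) ** transpose Q ** transpose (adj2 A) ** (G ** P))"
    unfolding metric_cofactor_def aH by (simp add: sc matrix_mul_assoc)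
  also have "G ** P = transpose P'"
    by (subst metric_frameD(4)[OF P]) (simp add: metric_frameD(2)[OF P] flip: matrix_mul_assoc)
  also have "(det H / (sqrt (det G) * sqrt (det H))) *\<^sub>R
      ((Q' ** Q) ** transpose Q ** transpose (adj2 A) ** transpose P') =
      (sqrt (det H) / sqrt (det G)) *\<^sub>R (transpose Q ** transpose (adj2 A) ** transpose P')"
    using pos by (simp add: metric_frameD(2)[OF Q] field_simps)
  also have "\<dots> = transpose (adj2 (Q' ** A ** P))"
    by (simp add: adj2_mult aQ aP sc tr matrix_transpose_mul matrix_mul_assoc)
  finally show ?thesis .
qed

text \<open>In frames \<open>B\<close> plus its cofactor matrix is [[m, -n], [n, m]], and
  \<open>m\<^sup>2 + n\<^sup>2\<close> is the square of the sum of the singular values, so on K this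
  matrix is a rotation. The squared distance from \<open>B\<close> to the rotation with first column
  (x, y) is \<open>t + (x - m)\<^sup>2 + (y - n)\<^sup>2\<close>, which has (m, n) as its only
  minimum.\<close>

lemma K_set_polar:
  assumes G: "gram_matrix G" and H: "gram_matrix H" and K: "A \<in> K_set G H"
  shows "polar_factor G H A = A + metric_cofactor G H A"
    and "dist_SO G H A = sqrt (1 - 2 * metric_det G H A)"
    and "metric_det G H A \<le> 1 / 4"
proof -
  obtain P P' where P: "metric_frame G P P'" using metric_frame_exists[OF G] .
  obtain Q Q' where Q: "metric_frame H Q Q'" using metric_frame_exists[OF H] .
  define B where "B = Q' ** A ** P"
  define t where "t = (B $ 1 $ 1)\<^sup>2 + (B $ 1 $ 2)\<^sup>2 + (B $ 2 $ 1)\<^sup>2 + (B $ 2 $ 2)\<^sup>2"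
  define m n where "m = B $ 1 $ 1 + B $ 2 $ 2" and "n = B $ 2 $ 1 - B $ 1 $ 2"
  have K': "metric_det G H A \<ge> 0" "sigma1 G H A + sigma2 G H A = 1" using K by (auto simp: K_set_def)
  note sv = singular_values[OF G H K'(1)]
  have J: "metric_det G H A = det B" unfolding B_def by (rule metric_det_frame[OF P Q])
  have "(hom_norm G H A)\<^sup>2 = t"
    unfolding hom_norm_frame[OF P Q, of A, folded B_def, folded t_def] by (simp add: t_def)
  moreover have "(sigma1 G H A + sigma2 G H A)\<^sup>2 = (hom_norm G H A)\<^sup>2 + 2 * metric_det G H A"
    by (simp add: power2_sum sv flip: sv(1))
  ultimately have t: "t = 1 - 2 * det B" using K' J by simp
  have mn: "m\<^sup>2 + n\<^sup>2 = 1"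
  proof -
    have "m\<^sup>2 + n\<^sup>2 = t + 2 * det B"
      by (simp add: m_def n_def t_def det_2 power2_eq_square algebra_simps)
    then show ?thesis using t by simp
  qed
  have t0: "t \<ge> 0" by (simp add: t_def)
  \<comment> \<open>The arithmetic-geometric mean inequality for two numbers of sum 1. It keeps
    \<open>1 - 2 * metric_det G H A\<close> away from zero.\<close>
  have "(sigma1 G H A - sigma2 G H A)\<^sup>2 \<ge> 0" by simp
  also have "(sigma1 G H A - sigma2 G H A)\<^sup>2 = (sigma1 G H A + sigma2 G H A)\<^sup>2 - 4 * metric_det G H A"
    unfolding sv(1)[symmetric] by (simp add: power2_eq_square algebra_simps)
  finally show "metric_det G H A \<le> 1 / 4" using K' by simp
  have fr: "Q' ** (X + Y) ** P = Q' ** X ** P + Q' ** Y ** P" "Q' ** (X - Y) ** P = Q' ** X ** P - Q' ** Y ** P" for X Y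
    by (simp_all add: matrix_eq_2 matrix_mult_component_2 algebra_simps)
  let ?O = "A + metric_cofactor G H A"
  have cof: "Q' ** ?O ** P = B + transpose (adj2 B)"
    unfolding fr metric_cofactor_frame[OF P Q G H] B_def ..
  have O: "?O \<in> SO_set G H"
    using mn unfolding SO_set_frame[OF P Q G H] cof by (simp add: m_def n_def)
  have dist: "hom_norm G H (A - X) = sqrt (t + ((Q' ** X ** P) $ 1 $ 1 - m)\<^sup>2 + ((Q' ** X ** P) $ 2 $ 1 - n)\<^sup>2)"
    if "X \<in> SO_set G H" for X
  proof -
    define x y where "x = (Q' ** X ** P) $ 1 $ 1" and "y = (Q' ** X ** P) $ 2 $ 1"
    have xy: "(Q' ** X ** P) $ 2 $ 2 = x" "(Q' ** X ** P) $ 1 $ 2 = - y" "x\<^sup>2 + y\<^sup>2 = 1"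
      using that unfolding SO_set_frame[OF P Q G H] x_def y_def by auto
    \<comment> \<open>Completing the square: the mixed terms are
      \<open>-2 * (x * m + y * n)\<close>, and the last two brackets cancel since both (x, y) and
      (m, n) are unit vectors.\<close>
    have "(B $ 1 $ 1 - x)\<^sup>2 + (B $ 1 $ 2 - (- y))\<^sup>2 + (B $ 2 $ 1 - y)\<^sup>2 + (B $ 2 $ 2 - x)\<^sup>2
        = t + (x - m)\<^sup>2 + (y - n)\<^sup>2 + (x\<^sup>2 + y\<^sup>2) - (m\<^sup>2 + n\<^sup>2)"
      by (simp add: t_def m_def n_def power2_eq_square algebra_simps)
    then show ?thesis unfolding hom_norm_frame[OF P Q] fr
      by (simp add: xy mn flip: B_def x_def y_def)
  qed
  have distO: "hom_norm G H (A - ?O) = sqrt t"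
    unfolding dist[OF O] cof by (simp add: m_def n_def)
  have "sqrt t \<le> hom_norm G H (A - X)" if "X \<in> SO_set G H" for X
    unfolding dist[OF that] by simp
  then have D: "dist_SO G H A = sqrt t"
    unfolding dist_SO_def by (intro cInf_eq_minimum) (use O in \<open>auto simp only: distO[symmetric] imageI\<close>)
  then show "dist_SO G H A = sqrt (1 - 2 * metric_det G H A)" using t J by simp
  show "polar_factor G H A = ?O"
    unfolding polar_factor_def
  proof (rule the_equality)
    fix X assume X: "X \<in> SO_set G H \<and> hom_norm G H (A - X) = dist_SO G H A"
    define x y where "x = (Q' ** X ** P) $ 1 $ 1" and "y = (Q' ** X ** P) $ 2 $ 1"
    have xy: "(Q' ** X ** P) $ 2 $ 2 = x" "(Q' ** X ** P) $ 1 $ 2 = - y"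
      using X unfolding SO_set_frame[OF P Q G H] x_def y_def by auto
    have "t + (x - m)\<^sup>2 + (y - n)\<^sup>2 = t" using X D dist[of X] by (simp add: x_def y_def)
    then have "x = m" "y = n" by (simp_all add: sum_power2_eq_zero_iff add.assoc)
    then have "Q' ** X ** P = Q' ** ?O ** P"
      unfolding cof using xy by (simp add: matrix_eq_2 x_def[symmetric] y_def[symmetric]) (simp add: m_def n_def)
    then have "Q ** (Q' ** X ** P) ** P' = Q ** (Q' ** ?O ** P) ** P'" by simp
    moreover have "Q ** (Q' ** Y ** P) ** P' = Y" for Y
    proof -
      have "Q ** (Q' ** Y ** P) ** P' = (Q ** Q') ** Y ** (P ** P')" by (simp add: matrix_mul_assoc)
      then show ?thesis by (simp add: metric_frameD(1)[OF P] metric_frameD(1)[OF Q])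
    qed
    ultimately show "X = ?O" by simp
  qed (use O D distO in simp_all)
qed

text \<open>The smaller singular value \<open>s\<close> is at most 1/2 and solves
  \<open>(1 - s) * s = J\<close>; the left side is injective on that range.\<close>

lemma K_set_sigma_cong:
  assumes "gram_matrix G" "gram_matrix H" "A \<in> K_set G H"
    and "gram_matrix G'" "gram_matrix H'" "A' \<in> K_set G' H'"
    and J: "metric_det G H A = metric_det G' H' A'"
  shows "sigma1 G H A = sigma1 G' H' A'" "sigma2 G H A = sigma2 G' H' A'"
proof -
  have e: "sigma2 G H A \<le> 1/2 \<and> (1 - sigma2 G H A) * sigma2 G H A = metric_det G H A \<and>
      sigma1 G H A = 1 - sigma2 G H A"
    if "gram_matrix G" "gram_matrix H" "A \<in> K_set G H" for G H A
  proof -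
    have K: "metric_det G H A \<ge> 0" "sigma1 G H A = 1 - sigma2 G H A" using that(3) by (auto simp: K_set_def)
    show ?thesis using singular_values[OF that(1,2) K(1)] unfolding K(2) by auto
  qed
  define a b where "a = sigma2 G H A" and "b = sigma2 G' H' A'"
  have "(1 - a) * a = (1 - b) * b" "a \<le> 1/2" "b \<le> 1/2"
    using e[OF assms(1-3)] e[OF assms(4-6)] J by (auto simp: a_def b_def)
  \<comment> \<open>If the second factor vanishes, then \<open>a + b = 1\<close> with both at most
    1/2, so both equal 1/2.\<close>
  then have "(a - b) * (1 - a - b) = 0" "a \<le> 1/2" "b \<le> 1/2" by (auto simp: algebra_simps)
  then have "a = b" by auto
  then show "sigma2 G H A = sigma2 G' H' A'" by (simp add: a_def b_def)
  then show "sigma1 G H A = sigma1 G' H' A'" using e[OF assms(1-3)] e[OF assms(4-6)] by simp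
qed

section \<open>Partial derivatives on Lipschitz regions\<close>

text \<open>The mean value theorem turns the second difference into \<open>h\<close> times a
  difference of two values of the derivative along \<open>p\<close>. Each is linearised at
  \<open>z\<close> with error at most \<open>e * (2 * h)\<close>. This needs the first derivative to
  be differentiable at \<open>z\<close> only.\<close>

lemma second_difference_approx:
  fixes f :: "'a::real_normed_vector \<Rightarrow> real"
  assumes "r > 0" and D: "\<And>y. y \<in> ball z r \<Longrightarrow> (f has_derivative D y) (at y)"
    and D2: "((\<lambda>y. D y p) has_derivative D2) (at z)"
    and pq: "norm p = 1" "norm q = 1" and "e > 0"
  obtains d where "d > 0" "\<And>h. 0 < h \<Longrightarrow> h < d \<Longrightarrow>
    \<bar>f (z + (h *\<^sub>R p + h *\<^sub>R q)) - f (z + h *\<^sub>R p) - f (z + h *\<^sub>R q) + f z - h * h * D2 q\<bar> \<le> 4 * e * (h * h)"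
proof -
  obtain d where d: "d > 0" "\<And>w. norm w < d \<Longrightarrow> \<bar>D (z + w) p - D z p - D2 w\<bar> \<le> e * norm w"
  proof -
    obtain d where "d > 0" "\<forall>y. norm (y - z) < d \<longrightarrow> norm (D y p - D z p - D2 (y - z)) \<le> e * norm (y - z)"
      using D2 \<open>e > 0\<close> unfolding has_derivative_at_alt by blast
    then show ?thesis by (intro that[of d]) (auto dest: spec[where x = "z + _"])
  qed
  have lin: "linear D2" using D2 has_derivative_linear by blast
  show ?thesis
  \<comment> \<open>All points used have the form \<open>z + (t *\<^sub>R p + s *\<^sub>R q)\<close>
    with coefficients at most \<open>h\<close> in absolute value, hence distance at most
    \<open>2 * h\<close> from \<open>z\<close>.\<close>
  proof (rule that[of "min d r / 2"])
    show "min d r / 2 > 0" using d \<open>r > 0\<close> by simp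
    fix h assume h: "0 < h" "h < min d r / 2"
    have nrm: "norm (t *\<^sub>R p + s *\<^sub>R q) \<le> 2 * h" if "\<bar>t\<bar> \<le> h" "\<bar>s\<bar> \<le> h" for t s
      using norm_triangle_ineq[of "t *\<^sub>R p" "s *\<^sub>R q"] that pq by simp
    have der: "((\<lambda>t. f (z + (t *\<^sub>R p + s *\<^sub>R q))) has_real_derivative D (z + (t *\<^sub>R p + s *\<^sub>R q)) p) (at t)"
      if "\<bar>t\<bar> \<le> h" "\<bar>s\<bar> \<le> h" for t s
    proof -
      have "z + (t *\<^sub>R p + s *\<^sub>R q) \<in> ball z r"
        using nrm[OF that] h by (simp add: dist_self_add)
      note Dy = D[OF this]
      have "((\<lambda>t. z + (t *\<^sub>R p + s *\<^sub>R q)) has_derivative (\<lambda>t. t *\<^sub>R p)) (at t)"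
        by (auto intro!: derivative_eq_intros)
      from has_derivative_compose[OF this Dy]
      have "((\<lambda>t. f (z + (t *\<^sub>R p + s *\<^sub>R q))) has_derivative
          (\<lambda>x. D (z + (t *\<^sub>R p + s *\<^sub>R q)) (x *\<^sub>R p))) (at t)" .
      moreover have "D (z + (t *\<^sub>R p + s *\<^sub>R q)) (x *\<^sub>R p) = D (z + (t *\<^sub>R p + s *\<^sub>R q)) p * x" for x
        using linear_scale[OF has_derivative_linear[OF Dy]] by simp
      ultimately show ?thesis by (simp add: has_field_derivative_def)
    qed
    \<comment> \<open>The increment in direction \<open>q\<close>, as a function of the position
      along \<open>p\<close>; \<open>g h - g 0\<close> is the second difference.\<close>
    define g where "g t = f (z + (t *\<^sub>R p + h *\<^sub>R q)) - f (z + (t *\<^sub>R p + 0 *\<^sub>R q))" for t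
    have "(g has_real_derivative D (z + (t *\<^sub>R p + h *\<^sub>R q)) p - D (z + (t *\<^sub>R p + 0 *\<^sub>R q)) p) (at t)"
      if "0 \<le> t" "t \<le> h" for t
      unfolding g_def using that h by (intro DERIV_diff der) auto
    from MVT2[OF h(1) this] obtain t where t: "0 < t" "t < h"
      "g h - g 0 = (h - 0) * (D (z + (t *\<^sub>R p + h *\<^sub>R q)) p - D (z + (t *\<^sub>R p + 0 *\<^sub>R q)) p)"
      by blast
    define a b where "a = D (z + (t *\<^sub>R p + h *\<^sub>R q)) p" and "b = D (z + (t *\<^sub>R p + 0 *\<^sub>R q)) p"
    have e1: "e * norm (t *\<^sub>R p + s *\<^sub>R q) \<le> e * (2 * h)" if "\<bar>s\<bar> \<le> h" for s
      using nrm[of t s] t that \<open>e > 0\<close> by (intro mult_left_mono) auto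
    have d': "\<bar>D (z + (t *\<^sub>R p + s *\<^sub>R q)) p - D z p - D2 (t *\<^sub>R p + s *\<^sub>R q)\<bar> \<le> e * (2 * h)" if "\<bar>s\<bar> \<le> h" for s
      using d(2)[of "t *\<^sub>R p + s *\<^sub>R q"] nrm[of t s] t h that e1[of s] by auto
    have D2l: "D2 (t *\<^sub>R p + s *\<^sub>R q) = t * D2 p + s * D2 q" for s
      by (simp add: linear_add[OF lin] linear_scale[OF lin])
    have "\<bar>a - D z p - (t * D2 p + h * D2 q)\<bar> \<le> e * (2 * h)"
      "\<bar>b - D z p - (t * D2 p + 0 * D2 q)\<bar> \<le> e * (2 * h)"
      unfolding a_def b_def D2l[symmetric] using h by (intro d'; simp)+
    then have "\<bar>a - b - h * D2 q\<bar> \<le> 4 * e * h" unfolding abs_le_iff by auto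
    then have "h * \<bar>a - b - h * D2 q\<bar> \<le> h * (4 * e * h)" using h by (intro mult_left_mono) auto
    then have "\<bar>h * (a - b - h * D2 q)\<bar> \<le> h * (4 * e * h)" using h by (simp add: abs_mult)
    moreover have "h * (a - b - h * D2 q) =
        f (z + (h *\<^sub>R p + h *\<^sub>R q)) - f (z + h *\<^sub>R p) - f (z + h *\<^sub>R q) + f z - h * h * D2 q"
    proof -
      have "g h - g 0 = h * (a - b)" using t(3) by (simp add: a_def b_def)
      then have "h * (a - b - h * D2 q) = g h - g 0 - h * h * D2 q"
        by (simp add: right_diff_distrib mult.assoc)
      then show ?thesis by (simp add: g_def)
    qed
    ultimately show "\<bar>f (z + (h *\<^sub>R p + h *\<^sub>R q)) - f (z + h *\<^sub>R p) - f (z + h *\<^sub>R q) + f z - h * h * D2 q\<bar>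
        \<le> 4 * e * (h * h)" by (simp add: mult_ac)
  qed
qed

text \<open>Young's theorem: the second difference does not change when \<open>p\<close> and
  \<open>q\<close> are exchanged, so both mixed derivatives are its limit after division by
  \<open>h * h\<close>.\<close>

lemma second_derivative_symmetric:
  fixes f :: "'a::real_normed_vector \<Rightarrow> real"
  assumes "r > 0" and D: "\<And>y. y \<in> ball z r \<Longrightarrow> (f has_derivative D y) (at y)"
    and Dp: "((\<lambda>y. D y p) has_derivative Dp) (at z)" and Dq: "((\<lambda>y. D y q) has_derivative Dq) (at z)"
    and pq: "norm p = 1" "norm q = 1"
  shows "Dp q = Dq p"
proof (rule ccontr)
  assume ne: "Dp q \<noteq> Dq p"
  \<comment> \<open>The two approximations are off by at most \<open>8 * e * (h * h)\<close>
    together, so a ninth of the supposed gap yields the contradiction.\<close>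
  define e where "e = \<bar>Dp q - Dq p\<bar> / 9"
  have e: "e > 0" using ne by (simp add: e_def)
  obtain d1 where d1: "d1 > 0" "\<And>h. 0 < h \<Longrightarrow> h < d1 \<Longrightarrow>
    \<bar>f (z + (h *\<^sub>R p + h *\<^sub>R q)) - f (z + h *\<^sub>R p) - f (z + h *\<^sub>R q) + f z - h * h * Dp q\<bar> \<le> 4 * e * (h * h)"
    using second_difference_approx[OF assms(1) D Dp pq e] by blast
  obtain d2 where d2: "d2 > 0" "\<And>h. 0 < h \<Longrightarrow> h < d2 \<Longrightarrow>
    \<bar>f (z + (h *\<^sub>R q + h *\<^sub>R p)) - f (z + h *\<^sub>R q) - f (z + h *\<^sub>R p) + f z - h * h * Dq p\<bar> \<le> 4 * e * (h * h)"
    using second_difference_approx[OF assms(1) D Dq pq(2,1) e] by blast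
  define h where "h = min d1 d2 / 2"
  have h: "0 < h" "h < d1" "h < d2" using d1 d2 by (auto simp: h_def)
  have "\<bar>h * h * Dp q - h * h * Dq p\<bar> \<le> 8 * e * (h * h)"
    using d1(2)[OF h(1,2)] d2(2)[OF h(1,3)] by (simp add: add.commute[of "h *\<^sub>R q"])
  moreover have "\<bar>h * h * Dp q - h * h * Dq p\<bar> = (h * h) * \<bar>Dp q - Dq p\<bar>"
    unfolding right_diff_distrib[symmetric] abs_mult by simp
  ultimately have "(h * h) * \<bar>Dp q - Dq p\<bar> \<le> (h * h) * (8 * e)"
    by (simp only: mult.commute[of "h * h" "8 * e"])
  then have "\<bar>Dp q - Dq p\<bar> \<le> 8 * e" using h(1) by simp
  then show False using e by (simp add: e_def)
qed

lemma Ck_on_2D: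
  assumes "Ck_on 2 f R"
  shows "f differentiable_on R" "pderiv_on R i f differentiable_on R"
    "continuous_on R (pderiv_on R j (pderiv_on R i f))"
  using assms by (simp_all add: numeral_2_eq_2)

lemma frechet_derivative_works_on:
  "f differentiable_on S \<Longrightarrow> y \<in> S \<Longrightarrow> (f has_derivative frechet_derivative f (at y within S)) (at y within S)"
  by (simp add: differentiable_on_def frechet_derivative_works)

text \<open>At interior points the relative derivatives are ordinary ones and Young's theorem
  applies to each component. Boundary points follow from the continuity of the second
  partials.\<close>

lemma pderiv_on_symmetric:
  fixes f :: "real^2 \<Rightarrow> real^'n"
  assumes R: "lipschitz_region R" and f: "Ck_on 2 f R" and z: "z \<in> R"
  shows "pderiv_on R i (pderiv_on R j f) z = pderiv_on R j (pderiv_on R i f) z"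
proof -
  have int: "pderiv_on R i (pderiv_on R j f) y $ a = pderiv_on R j (pderiv_on R i f) y $ a"
    if y: "y \<in> interior R" for a y
  proof -
    obtain r where r: "r > 0" "ball y r \<subseteq> interior R"
      using y open_contains_ball open_interior by blast
    have d: "((\<lambda>x. k x $ a) has_derivative (\<lambda>h. frechet_derivative k (at x within R) h $ a)) (at x)"
      if "x \<in> ball y r" "k differentiable_on R" for k :: "real^2 \<Rightarrow> real^'n" and x
    proof -
      have x: "x \<in> interior R" "x \<in> R" using r(2) that(1) interior_subset[of R] by blast+
      have "(k has_derivative frechet_derivative k (at x within R)) (at x)"
        using frechet_derivative_works_on[OF that(2) x(2)] at_within_interior[OF x(1)] by simp
      then show ?thesis by (rule bounded_linear.has_derivative[OF bounded_linear_vec_nth])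
    qed
    have D: "((\<lambda>x. f x $ a) has_derivative (\<lambda>h. frechet_derivative f (at x within R) h $ a)) (at x)"
      if "x \<in> ball y r" for x
      using that by (rule d[OF _ Ck_on_2D(1)[OF f]])
    have y0: "y \<in> ball y r" using r(1) by simp
    have p: "((\<lambda>x. frechet_derivative f (at x within R) (axis i 1) $ a) has_derivative
        (\<lambda>h. frechet_derivative (pderiv_on R i f) (at y within R) h $ a)) (at y)" for i
      using d[OF y0 Ck_on_2D(2)[OF f, of i]] unfolding pderiv_on_def .
    have "norm (axis i 1 :: real^2) = 1" for i by simp
    from second_derivative_symmetric[OF r(1) D p p this this]
    show ?thesis by (simp only: pderiv_on_def)
  qed
  show ?thesis unfolding vec_eq_iff
  proof
    fix a
    show "pderiv_on R i (pderiv_on R j f) z $ a = pderiv_on R j (pderiv_on R i f) z $ a"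
      by (rule lipschitz_region_eq_if_eq_interior[OF R _ _ int z])
         (intro continuous_intros Ck_on_2D[OF f])+
  qed
qed

lemma linear_expand_2:
  fixes D :: "real^2 \<Rightarrow> 'b::real_vector"
  assumes "linear D"
  shows "D v = v $ 1 *\<^sub>R D (axis 1 1) + v $ 2 *\<^sub>R D (axis 2 1)"
proof -
  have "v = v $ 1 *\<^sub>R axis 1 1 + v $ 2 *\<^sub>R axis 2 1"
    by (simp add: vec_eq_iff forall_2 axis_def)
  then have "D v = D (v $ 1 *\<^sub>R axis 1 1 + v $ 2 *\<^sub>R axis 2 1)" by (rule arg_cong)
  also have "\<dots> = v $ 1 *\<^sub>R D (axis 1 1) + v $ 2 *\<^sub>R D (axis 2 1)"
    by (simp only: linear_add[OF assms] linear_scale[OF assms])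
  finally show ?thesis .
qed

text \<open>\<open>frechet_derivative\<close> is a choice; uniqueness on Lipschitz regions lets any
  known derivative take its place. The calculus rules below all rest on this.\<close>

lemma pderiv_on_eqI:
  assumes "lipschitz_region R" "z \<in> R" "(f has_derivative D) (at z within R)"
  shows "pderiv_on R i f z = D (axis i 1)"
  using frechet_derivative_lipschitz_region[OF assms] by (simp add: pderiv_on_def)

text \<open>A metric lives on a whole chart image, whereas a map and its forms live on the
  relatively open part that is sent into the target chart. Derivatives with respect to the two
  regions have to be interchangeable.\<close>

lemma pderiv_on_subset:
  assumes "lipschitz_region S" "openin (top_of_set S) R" "z \<in> R" "f differentiable (at z within S)"
  shows "pderiv_on R i f z = pderiv_on S i f z"
proof -
  have "R \<subseteq> S" using assms(2) openin_imp_subset by auto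
  have "(f has_derivative frechet_derivative f (at z within S)) (at z within R)"
    using assms(4) \<open>R \<subseteq> S\<close> has_derivative_subset unfolding frechet_derivative_works by blast
  from pderiv_on_eqI[OF lipschitz_region_openin[OF assms(1,2)] assms(3) this]
  show ?thesis by (simp add: pderiv_on_def)
qed

section \<open>Product, sum and chain rules relative to a region\<close>

lemma pderiv_on_mult:
  fixes u v :: "real^2 \<Rightarrow> real"
  assumes R: "lipschitz_region R" "z \<in> R"
    and u: "u differentiable (at z within R)" and v: "v differentiable (at z within R)"
  shows "pderiv_on R i (\<lambda>y. u y * v y) z = pderiv_on R i u z * v z + u z * pderiv_on R i v z"
  using pderiv_on_eqI[OF R has_derivative_mult[OF u[unfolded frechet_derivative_works]
      v[unfolded frechet_derivative_works]], of i]
  by (simp add: pderiv_on_def)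

lemma pderiv_on_add:
  assumes R: "lipschitz_region R" "z \<in> R"
    and u: "u differentiable (at z within R)" and v: "v differentiable (at z within R)"
  shows "pderiv_on R i (\<lambda>y. u y + v y) z = pderiv_on R i u z + pderiv_on R i v z"
  using pderiv_on_eqI[OF R has_derivative_add[OF u[unfolded frechet_derivative_works]
      v[unfolded frechet_derivative_works]], of i]
  by (simp add: pderiv_on_def)

lemma pderiv_on_minus:
  assumes R: "lipschitz_region R" "z \<in> R" and u: "u differentiable (at z within R)"
  shows "pderiv_on R i (\<lambda>y. - u y) z = - pderiv_on R i u z"
  using pderiv_on_eqI[OF R has_derivative_minus[OF u[unfolded frechet_derivative_works]], of i]
  by (simp add: pderiv_on_def)

lemma pderiv_on_nth:
  fixes u :: "real^2 \<Rightarrow> real^'n"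
  assumes R: "lipschitz_region R" "z \<in> R" and u: "u differentiable (at z within R)"
  shows "pderiv_on R i (\<lambda>y. u y $ a) z = pderiv_on R i u z $ a"
  using pderiv_on_eqI[OF R bounded_linear.has_derivative[OF bounded_linear_vec_nth
        u[unfolded frechet_derivative_works]], of i]
  by (simp add: pderiv_on_def)

lemma pderiv_on_real_compose:
  fixes u :: "real^2 \<Rightarrow> real"
  assumes R: "lipschitz_region R" "z \<in> R" and u: "u differentiable (at z within R)"
    and k: "(k has_real_derivative k') (at (u z))"
  shows "pderiv_on R i (\<lambda>y. k (u y)) z = k' * pderiv_on R i u z"
  using pderiv_on_eqI[OF R has_derivative_compose[OF u[unfolded frechet_derivative_works]
        k[unfolded has_field_derivative_def]], of i]
  by (simp add: pderiv_on_def)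

lemma pderiv_on_compose:
  fixes k :: "real^2 \<Rightarrow> real"
  assumes R: "lipschitz_region R" "z \<in> R" and f: "f differentiable (at z within R)"
    and "f ` R \<subseteq> T" and k: "k differentiable (at (f z) within T)"
  shows "(\<lambda>y. k (f y)) differentiable (at z within R)"
    and "pderiv_on R i (\<lambda>y. k (f y)) z =
      pderiv_on T 1 k (f z) * pderiv_on R i f z $ 1 + pderiv_on T 2 k (f z) * pderiv_on R i f z $ 2"
proof -
  let ?D = "frechet_derivative k (at (f z) within T)"
  have k': "(k has_derivative ?D) (at (f z) within f ` R)"
    using k assms(4) has_derivative_subset unfolding frechet_derivative_works by blast
  have c: "((k \<circ> f) has_derivative ?D \<circ> frechet_derivative f (at z within R)) (at z within R)"
    by (rule diff_chain_within[OF f[unfolded frechet_derivative_works] k'])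
  then show "(\<lambda>y. k (f y)) differentiable (at z within R)"
    using differentiableI by (fastforce simp: o_def)
  have lin: "linear ?D" using k linear_frechet_derivative by blast
  show "pderiv_on R i (\<lambda>y. k (f y)) z =
      pderiv_on T 1 k (f z) * pderiv_on R i f z $ 1 + pderiv_on T 2 k (f z) * pderiv_on R i f z $ 2"
    using pderiv_on_eqI[OF R c, of i] linear_expand_2[OF lin, of "frechet_derivative f (at z within R) (axis i 1)"]
    by (simp add: pderiv_on_def o_def mult.commute)
qed

lemma jacobian_component: "jacobian f (at z within R) $ a $ i = pderiv_on R i f z $ a"
  for f :: "real^2 \<Rightarrow> real^'n"
  by (simp add: jacobian_def matrix_def pderiv_on_def)

section \<open>Christoffel symbols and the Piola identity\<close>

lemma pderiv_on_diff:
  assumes R: "lipschitz_region R" "z \<in> R"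
    and u: "u differentiable (at z within R)" and v: "v differentiable (at z within R)"
  shows "pderiv_on R i (\<lambda>y. u y - v y) z = pderiv_on R i u z - pderiv_on R i v z"
  using pderiv_on_eqI[OF R has_derivative_diff[OF u[unfolded frechet_derivative_works]
      v[unfolded frechet_derivative_works]], of i]
  by (simp add: pderiv_on_def)

lemma differentiable_vec_nth:
  "u differentiable F \<Longrightarrow> (\<lambda>y. u y $ a) differentiable F" for u :: "_ \<Rightarrow> ('b::real_normed_vector)^'n"
  using bounded_linear.has_derivative[OF bounded_linear_vec_nth] unfolding differentiable_def by blast

lemma differentiable_matrix_2:
  fixes u :: "real^2 \<Rightarrow> real^2^2"
  assumes "\<And>i j. (\<lambda>y. u y $ i $ j) differentiable F"
  shows "u differentiable F"
proof -
  have s: "(\<lambda>y. u y $ i $ j *\<^sub>R (axis i (axis j 1) :: real^2^2)) differentiable F" for i j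
    using bounded_linear.has_derivative[OF bounded_linear_scaleR_left, of "\<lambda>y. u y $ i $ j"] assms[of i j]
    unfolding differentiable_def by blast
  have "u = (\<lambda>y. (u y $ 1 $ 1 *\<^sub>R axis 1 (axis 1 1) + u y $ 1 $ 2 *\<^sub>R axis 1 (axis 2 1)) +
      (u y $ 2 $ 1 *\<^sub>R axis 2 (axis 1 1) + u y $ 2 $ 2 *\<^sub>R axis 2 (axis 2 1)))"
    by (simp add: fun_eq_iff vec_eq_iff forall_2 axis_def)
  moreover have "\<dots> differentiable F" by (intro differentiable_add s)
  ultimately show ?thesis by simp
qed

lemma differentiable_real_compose:
  fixes u :: "'a::real_normed_vector \<Rightarrow> real"
  assumes "u differentiable (at z within R)" "(k has_real_derivative k') (at (u z))"
  shows "(\<lambda>y. k (u y)) differentiable (at z within R)"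
  using has_derivative_compose[OF assms(1)[unfolded frechet_derivative_works]
      assms(2)[unfolded has_field_derivative_def]] differentiableI by blast

lemma inverse_sqrt_has_real_derivative:
  assumes "x > 0"
  shows "((\<lambda>x. 1 / sqrt x) has_real_derivative - 1 / (2 * x * sqrt x)) (at x)"
  using assms by (auto intro!: derivative_eq_intros simp: field_simps)

text \<open>The derivative of the determinant combined with metric compatibility: the contracted
  Christoffel symbol is the logarithmic derivative of the volume density.\<close>

lemma christoffel_contract_det:
  assumes S: "lipschitz_region S" "z \<in> S" and g: "g differentiable_on S"
    and gram: "\<And>y. y \<in> S \<Longrightarrow> gram_matrix (g y)"
  shows "(\<lambda>y. det (g y)) differentiable (at z within S)"
    and "pderiv_on S i (\<lambda>y. det (g y)) z =
      2 * det (g z) * (christoffel S g z 1 i 1 + christoffel S g z 2 i 2)"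
proof -
  have d: "(\<lambda>y. g y $ a $ b) differentiable (at z within S)" for a b
    using g S(2) by (intro differentiable_vec_nth) (simp add: differentiable_on_def)
  have compat: "pderiv_on S k (\<lambda>y. g y $ i $ j) z = (\<Sum>m\<in>UNIV. christoffel S g z m k i * g z $ m $ j
      + christoffel S g z m k j * g z $ i $ m)" for i j k
    using S(2) gram by (rule christoffel_metric_compatible)
  show "(\<lambda>y. det (g y)) differentiable (at z within S)"
    unfolding det_2 by (intro differentiable_diff differentiable_mult d)
  have "pderiv_on S i (\<lambda>y. det (g y)) z =
    (pderiv_on S i (\<lambda>y. g y $ 1 $ 1) z * g z $ 2 $ 2 + g z $ 1 $ 1 * pderiv_on S i (\<lambda>y. g y $ 2 $ 2) z)
    - (pderiv_on S i (\<lambda>y. g y $ 1 $ 2) z * g z $ 2 $ 1 + g z $ 1 $ 2 * pderiv_on S i (\<lambda>y. g y $ 2 $ 1) z)"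
    unfolding det_2
    by (subst pderiv_on_diff[OF S], (intro differentiable_mult d)+, (subst pderiv_on_mult[OF S d d])+) simp
  also have "\<dots> = 2 * det (g z) * (christoffel S g z 1 i 1 + christoffel S g z 2 i 2)"
    unfolding compat det_2
    by (simp add: sum_2 gram_matrix_pos(3)[OF gram[OF S(2)]] algebra_simps)
  finally show "pderiv_on S i (\<lambda>y. det (g y)) z =
      2 * det (g z) * (christoffel S g z 1 i 1 + christoffel S g z 2 i 2)" .
qed

text \<open>The weight \<open>1 / sqrt (det (g y))\<close> contributes minus the contracted
  Christoffel symbol.\<close>

lemma pderiv_on_div_sqrt_det:
  assumes S: "lipschitz_region S" "z \<in> S" and g: "g differentiable_on S"
    and gram: "\<And>y. y \<in> S \<Longrightarrow> gram_matrix (g y)"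
    and u: "u differentiable (at z within S)"
  shows "(\<lambda>y. u y / sqrt (det (g y))) differentiable (at z within S)"
    and "pderiv_on S i (\<lambda>y. u y / sqrt (det (g y))) z =
      (pderiv_on S i u z - u z * (christoffel S g z 1 i 1 + christoffel S g z 2 i 2)) / sqrt (det (g z))"
proof -
  have pos: "det (g z) > 0" using gram_matrix_pos gram S by blast
  have D: "(\<lambda>y. det (g y)) differentiable (at z within S)"
    "pderiv_on S i (\<lambda>y. det (g y)) z =
      2 * det (g z) * (christoffel S g z 1 i 1 + christoffel S g z 2 i 2)"
    by (rule christoffel_contract_det[OF S g gram]; assumption)+
  note k = inverse_sqrt_has_real_derivative[OF pos]
  have e: "(\<lambda>y. u y / sqrt (det (g y))) = (\<lambda>y. u y * (1 / sqrt (det (g y))))" by simp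
  have d: "(\<lambda>y. 1 / sqrt (det (g y))) differentiable (at z within S)"
    by (rule differentiable_real_compose[OF D(1) k])
  show "(\<lambda>y. u y / sqrt (det (g y))) differentiable (at z within S)"
    unfolding e by (rule differentiable_mult[OF u d])
  have dk: "pderiv_on S i (\<lambda>y. 1 / sqrt (det (g y))) z =
      - (christoffel S g z 1 i 1 + christoffel S g z 2 i 2) / sqrt (det (g z))"
    unfolding pderiv_on_real_compose[OF S D(1) k] D(2) using pos by (simp add: field_simps)
  show "pderiv_on S i (\<lambda>y. u y / sqrt (det (g y))) z =
      (pderiv_on S i u z - u z * (christoffel S g z 1 i 1 + christoffel S g z 2 i 2)) / sqrt (det (g z))"
    unfolding e pderiv_on_mult[OF S u d] dk by (simp add: divide_inverse algebra_simps)
qed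

text \<open>The form \<open>g\<^sub>k\<^sub>j / sqrt (det g) dx\<^sup>j\<close> is, up to sign, the Hodge dual of a closed coordinate form.\<close>

lemma coclosed_coordinate_form:
  assumes S: "lipschitz_region S" "z \<in> S" and g: "g differentiable_on S"
    and gram: "\<And>y. y \<in> S \<Longrightarrow> gram_matrix (g y)"
  shows "(\<Sum>i\<in>UNIV. \<Sum>j\<in>UNIV. matrix_inv (g z) $ i $ j *
      (pderiv_on S i (\<lambda>y. g y $ k $ j / sqrt (det (g y))) z
       - (\<Sum>l\<in>UNIV. christoffel S g z l i j * (g z $ k $ l / sqrt (det (g z)))))) = 0"
proof -
  have d: "(\<lambda>y. g y $ a $ b) differentiable (at z within S)" for a b
    using g S(2) by (intro differentiable_vec_nth) (simp add: differentiable_on_def)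
  have pos: "det (g z) > 0" using gram_matrix_pos gram S by blast
  have compat: "pderiv_on S k (\<lambda>y. g y $ i $ j) z = (\<Sum>m\<in>UNIV. christoffel S g z m k i * g z $ m $ j
      + christoffel S g z m k j * g z $ i $ m)" for i j k
    using S(2) gram by (rule christoffel_metric_compatible)
  have pd: "pderiv_on S i (\<lambda>y. u y / sqrt (det (g y))) z =
      (pderiv_on S i u z - u z * (christoffel S g z 1 i 1 + christoffel S g z 2 i 2)) / sqrt (det (g z))"
    if "u differentiable (at z within S)" for u i
    using S g gram that by (rule pderiv_on_div_sqrt_det(2))
  define c where "c = christoffel S g z"
  have c: "c m i j = c m j i" for m i j
    unfolding c_def using S(2) gram by (rule christoffel_torsion_free)
  have c21: "c m 2 1 = c m 1 2" for m by (rule c)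
  have sym: "g z $ 2 $ 1 = g z $ 1 $ 2" using gram_matrix_pos(3) gram S by blast
  let ?s = "sqrt (det (g z))"
  \<comment> \<open>Metric compatibility splits the derivative of \<open>g y $ k $ j\<close> into
    two sums, and the connection term cancels the one with the symbols
    \<open>c m i j\<close>.\<close>
  have e: "pderiv_on S i (\<lambda>y. g y $ k $ j / sqrt (det (g y))) z
       - (\<Sum>l\<in>UNIV. c l i j * (g z $ k $ l / ?s))
     = ((\<Sum>m\<in>UNIV. c m i k * g z $ m $ j) - g z $ k $ j * (c 1 i 1 + c 2 i 2)) / ?s" for i j
    unfolding pd[OF d] compat c_def[symmetric]
    by (simp add: sum_2 divide_inverse algebra_simps)
  \<comment> \<open>Contraction with the inverse metric leaves the difference of the traces of
    \<open>c m i k\<close> and \<open>c m k i\<close>, which vanishes since the connection is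
    torsion-free. The adjugate in place of the inverse makes this a polynomial identity.\<close>
  have "(\<Sum>i\<in>UNIV. \<Sum>j\<in>UNIV. adj2 (g z) $ i $ j *
     ((\<Sum>m\<in>UNIV. c m i k * g z $ m $ j) - g z $ k $ j * (c 1 i 1 + c 2 i 2))) = 0"
    using exhaust_2[of k] by (elim disjE) (simp_all add: sum_2 sym c21 algebra_simps)
  then have "(\<Sum>i\<in>UNIV. \<Sum>j\<in>UNIV. adj2 (g z) $ i $ j *
     ((\<Sum>m\<in>UNIV. c m i k * g z $ m $ j) - g z $ k $ j * (c 1 i 1 + c 2 i 2))) * (1 / (det (g z) * ?s)) = 0"
    by simp
  then show ?thesis using pos unfolding c_def[symmetric] e matrix_inv_2[OF less_imp_neq[OF pos, symmetric]]
    by (simp add: sum_2 divide_inverse algebra_simps)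
qed

text \<open>\<open>adj2 g / sqrt (det g)\<close> is the contravariant metric multiplied by the
  volume density. This is the classical formula for its divergence, which up to the density gives
  the Laplacian of a coordinate function.\<close>

lemma divergence_cofactor_density:
  assumes S: "lipschitz_region S" "z \<in> S" and g: "g differentiable_on S"
    and gram: "\<And>y. y \<in> S \<Longrightarrow> gram_matrix (g y)"
  shows "(\<Sum>b\<in>UNIV. pderiv_on S b (\<lambda>y. adj2 (g y) $ a $ b / sqrt (det (g y))) z) =
    - (\<Sum>b\<in>UNIV. \<Sum>c\<in>UNIV. christoffel S g z a b c * (adj2 (g z) $ b $ c / sqrt (det (g z))))"
proof -
  have d: "(\<lambda>y. g y $ a $ b) differentiable (at z within S)" for a b
    using g S(2) by (intro differentiable_vec_nth) (simp add: differentiable_on_def)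
  have d': "(\<lambda>y. - g y $ a $ b) differentiable (at z within S)" for a b
    using d differentiable_minus by blast
  have compat: "pderiv_on S k (\<lambda>y. g y $ i $ j) z = (\<Sum>m\<in>UNIV. christoffel S g z m k i * g z $ m $ j
      + christoffel S g z m k j * g z $ i $ m)" for i j k
    using S(2) gram by (rule christoffel_metric_compatible)
  have pd: "pderiv_on S i (\<lambda>y. u y / sqrt (det (g y))) z =
      (pderiv_on S i u z - u z * (christoffel S g z 1 i 1 + christoffel S g z 2 i 2)) / sqrt (det (g z))"
    if "u differentiable (at z within S)" for u i
    using S g gram that by (rule pderiv_on_div_sqrt_det(2))
  define c where "c = christoffel S g z"
  have c: "c m i j = c m j i" for m i j
    unfolding c_def using S(2) gram by (rule christoffel_torsion_free)
  have c21: "c m 2 1 = c m 1 2" for m by (rule c)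
  have sym: "g z $ 2 $ 1 = g z $ 1 $ 2" using gram_matrix_pos(3) gram S by blast
  show ?thesis
    unfolding c_def[symmetric] sum_2
    using exhaust_2[of a]
  proof (elim disjE)
    assume a: "a = 1"
    show "pderiv_on S 1 (\<lambda>y. adj2 (g y) $ a $ 1 / sqrt (det (g y))) z +
      pderiv_on S 2 (\<lambda>y. adj2 (g y) $ a $ 2 / sqrt (det (g y))) z =
      - (c a 1 1 * (adj2 (g z) $ 1 $ 1 / sqrt (det (g z))) + c a 1 2 * (adj2 (g z) $ 1 $ 2 / sqrt (det (g z))) +
       (c a 2 1 * (adj2 (g z) $ 2 $ 1 / sqrt (det (g z))) + c a 2 2 * (adj2 (g z) $ 2 $ 2 / sqrt (det (g z)))))"
      unfolding a adj2_component
        pd[OF d] pd[OF d']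
        pderiv_on_minus[OF S d] compat c_def[symmetric]
      by (simp add: sum_2 sym c21 divide_inverse algebra_simps)
  next
    assume a: "a = 2"
    show "pderiv_on S 1 (\<lambda>y. adj2 (g y) $ a $ 1 / sqrt (det (g y))) z +
      pderiv_on S 2 (\<lambda>y. adj2 (g y) $ a $ 2 / sqrt (det (g y))) z =
      - (c a 1 1 * (adj2 (g z) $ 1 $ 1 / sqrt (det (g z))) + c a 1 2 * (adj2 (g z) $ 1 $ 2 / sqrt (det (g z))) +
       (c a 2 1 * (adj2 (g z) $ 2 $ 1 / sqrt (det (g z))) + c a 2 2 * (adj2 (g z) $ 2 $ 2 / sqrt (det (g z)))))"
      unfolding a adj2_component
        pd[OF d] pd[OF d']
        pderiv_on_minus[OF S d] compat c_def[symmetric]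
      by (simp add: sum_2 sym c21 divide_inverse algebra_simps)
  qed
qed

text \<open>\<open>orthonormal_frame_sum_2\<close> replaces the chosen frame by a contraction with
  the inverse metric, the form in which coordinate computations are possible.\<close>

lemma codifferential_eq:
  assumes "gram_matrix (g z)"
  shows "codifferential S g T h R f \<omega> z =
    - (\<Sum>i\<in>UNIV. \<Sum>j\<in>UNIV. matrix_inv (g z) $ i $ j *\<^sub>R covariant_deriv S g T h R f \<omega> z i j)"
proof -
  define E where "E = (SOME E. orthonormal_frame (g z) E)"
  have "orthonormal_frame (g z) E"
    unfolding E_def using orthonormal_frame_exists[OF assms] by (rule someI_ex)
  note orthonormal_frame_sum_2[OF assms this, unfolded sum_2, symmetric]
  then show ?thesis unfolding codifferential_def Let_def E_def[symmetric] sum_2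
    by (simp add: scaleR_left_distrib)
qed

text \<open>A Leibniz rule in which every term but one vanishes: the cofactor form itself is
  coclosed, so only the derivative of the factor \<open>F\<close> survives. For constant
  \<open>F\<close> this is the Piola identity.\<close>

lemma cofactor_form:
  fixes F :: "real^2 \<Rightarrow> real" and f :: "real^2 \<Rightarrow> real^2"
  assumes S: "lipschitz_region S" and g: "g differentiable_on S"
    and gram_g: "\<And>y. y \<in> S \<Longrightarrow> gram_matrix (g y)"
    and T: "lipschitz_region T" and h: "h differentiable_on T"
    and gram_h: "\<And>y. y \<in> T \<Longrightarrow> gram_matrix (h y)"
    and RS: "openin (top_of_set S) R" and fT: "f ` R \<subseteq> T" and f: "Ck_on 2 f R"
    and F: "F differentiable_on R"
    and \<omega>: "\<And>y. y \<in> R \<Longrightarrow>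
      \<omega> y = F y *\<^sub>R metric_cofactor (g y) (h (f y)) (jacobian f (at y within R))"
    and z: "z \<in> R"
  shows "\<omega> differentiable (at z within R)"
    and "codifferential S g T h R f \<omega> z =
      - (1 / (sqrt (det (g z)) * sqrt (det (h (f z))))) *\<^sub>R
        ((adj2 (h (f z)) ** transpose (adj2 (jacobian f (at z within R)))) *v (\<chi> i. pderiv_on R i F z))"
proof -
  have R: "lipschitz_region R" using lipschitz_region_openin[OF S RS] .
  have "R \<subseteq> S" using RS openin_imp_subset by auto
  then have zS: "z \<in> S" and fz: "f z \<in> T" using z fT by auto
  note Rz = R z and Sz = S zS and Tz = T fz
  \<comment> \<open>The three factors of the cofactor form: \<open>hh\<close> belongs to the target
    metric, \<open>cof\<close> to the Jacobian matrix of \<open>f\<close>, and \<open>gg k\<close>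
    is a coclosed one-form of the source metric. In these terms \<open>\<omega>\<close> is the sum
    over \<open>k\<close> of \<open>F * Y a k\<close> times \<open>gg k\<close>.\<close>
  define hh where "hh a b = (\<lambda>w. adj2 (h w) $ a $ b / sqrt (det (h w)))" for a b
  define cof where "cof b k = (\<lambda>y. transpose (adj2 (jacobian f (at y within R))) $ b $ k)" for b k
  define gg where "gg k j = (\<lambda>y. g y $ k $ j / sqrt (det (g y)))" for k j
  define Y where "Y a k = (\<lambda>y. hh a 1 (f y) * cof 1 k y + hh a 2 (f y) * cof 2 k y)" for a k
  have dS: "u differentiable (at z within R)" if "u differentiable (at z within S)" for u :: "real^2 \<Rightarrow> real"
    using that \<open>R \<subseteq> S\<close> differentiable_within_subset by blast
  have df: "f differentiable (at z within R)" using Ck_on_2D(1)[OF f] z by (simp add: differentiable_on_def)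
  have dF: "F differentiable (at z within R)" using F z by (simp add: differentiable_on_def)
  have dgS: "gg k j differentiable (at z within S)" for k j
    unfolding gg_def using Sz g gram_g
    by (rule pderiv_on_div_sqrt_det(1)) (use g zS in \<open>auto intro!: differentiable_vec_nth simp: differentiable_on_def\<close>)
  note dg = dS[OF dgS]
  have pg: "pderiv_on R i (gg k j) z = pderiv_on S i (gg k j) z" for i k j
    by (rule pderiv_on_subset[OF S RS z dgS])
  have dh0: "(\<lambda>w. h w $ a $ b) differentiable (at (f z) within T)" for a b
    using h fz by (auto intro!: differentiable_vec_nth simp: differentiable_on_def)
  have dadj: "(\<lambda>w. adj2 (h w) $ a $ b) differentiable (at (f z) within T)" for a b
    using exhaust_2[of a] exhaust_2[of b] dh0 differentiable_minus[OF dh0] by (elim disjE) simp_all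
  have dhT: "hh a b differentiable (at (f z) within T)" for a b
    unfolding hh_def using Tz h gram_h dadj by (rule pderiv_on_div_sqrt_det(1))
  note dh = pderiv_on_compose(1)[OF Rz df fT dhT]
  note ph = pderiv_on_compose(2)[OF Rz df fT dhT]
  have dA: "(\<lambda>y. jacobian f (at y within R) $ a $ i) differentiable (at z within R)"
    and pA: "pderiv_on R j (\<lambda>y. jacobian f (at y within R) $ a $ i) z = pderiv_on R j (pderiv_on R i f) z $ a"
    for a i j
  proof -
    have "pderiv_on R i f differentiable (at z within R)"
      using Ck_on_2D(2)[OF f] z by (simp add: differentiable_on_def)
    then show "(\<lambda>y. jacobian f (at y within R) $ a $ i) differentiable (at z within R)"
      "pderiv_on R j (\<lambda>y. jacobian f (at y within R) $ a $ i) z = pderiv_on R j (pderiv_on R i f) z $ a"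
      unfolding jacobian_component by (auto intro: differentiable_vec_nth pderiv_on_nth[OF Rz])
  qed
  have dcof: "cof b k differentiable (at z within R)" for b k
    unfolding cof_def transpose_component
    using exhaust_2[of b] exhaust_2[of k] dA differentiable_minus[OF dA] by (elim disjE) simp_all
  \<comment> \<open>The flat Piola identity: up to sign, the two terms are the mixed second partials
    of one component of \<open>f\<close>.\<close>
  have divcof: "pderiv_on R 1 (cof b 1) z + pderiv_on R 2 (cof b 2) z = 0" for b
    unfolding cof_def transpose_component
    using exhaust_2[of b] pderiv_on_symmetric[OF R f z, of 1 2]
    by (elim disjE) (simp_all add: pderiv_on_minus[OF Rz dA] pA)
  have dY: "Y a k differentiable (at z within R)" for a k
    unfolding Y_def by (intro differentiable_add differentiable_mult dh dcof)
  have pY: "pderiv_on R i (Y a k) z =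
      (pderiv_on R i (\<lambda>y. hh a 1 (f y)) z * cof 1 k z + hh a 1 (f z) * pderiv_on R i (cof 1 k) z) +
      (pderiv_on R i (\<lambda>y. hh a 2 (f y)) z * cof 2 k z + hh a 2 (f z) * pderiv_on R i (cof 2 k) z)" for a i k
    unfolding Y_def pderiv_on_add[OF Rz differentiable_mult[OF dh dcof] differentiable_mult[OF dh dcof]]
      pderiv_on_mult[OF Rz dh dcof] ..
  have \<omega>c: "\<omega> y $ a $ j = F y * Y a 1 y * gg 1 j y + F y * Y a 2 y * gg 2 j y" if "y \<in> R" for y a j
    unfolding \<omega>[OF that]
    by (simp add: metric_cofactor_def matrix_mult_component_2 Y_def hh_def cof_def gg_def divide_inverse algebra_simps)
  have dX: "(\<lambda>y. F y * Y a k y) differentiable (at z within R)" for a k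
    by (intro differentiable_mult dF dY)
  have d\<omega>: "(\<lambda>y. \<omega> y $ a $ j) differentiable (at z within R)" for a j
  proof -
    have "(\<lambda>y. F y * Y a 1 y * gg 1 j y + F y * Y a 2 y * gg 2 j y) differentiable (at z within R)"
      by (intro differentiable_add differentiable_mult[OF dX dg])
    then obtain D where "((\<lambda>y. F y * Y a 1 y * gg 1 j y + F y * Y a 2 y * gg 2 j y) has_derivative D) (at z within R)"
      unfolding differentiable_def by blast
    from differentiableI[OF has_derivative_transform[OF z \<omega>c this]] show ?thesis .
  qed
  then show "\<omega> differentiable (at z within R)" by (rule differentiable_matrix_2)
  have p\<omega>0: "pderiv_on R i (\<lambda>y. \<omega> y $ a $ j) z =
      pderiv_on R i (\<lambda>y. F y * Y a 1 y * gg 1 j y + F y * Y a 2 y * gg 2 j y) z" for i a j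
    by (rule pderiv_on_cong[OF z]) (rule \<omega>c)
  have p\<omega>: "pderiv_on R i (\<lambda>y. \<omega> y $ a $ j) z =
      ((pderiv_on R i F z * Y a 1 z + F z * pderiv_on R i (Y a 1) z) * gg 1 j z
        + F z * Y a 1 z * pderiv_on S i (gg 1 j) z) +
      ((pderiv_on R i F z * Y a 2 z + F z * pderiv_on R i (Y a 2) z) * gg 2 j z
        + F z * Y a 2 z * pderiv_on S i (gg 2 j) z)" for i a j
    unfolding p\<omega>0 pderiv_on_add[OF Rz differentiable_mult[OF dX dg] differentiable_mult[OF dX dg]]
      pderiv_on_mult[OF Rz dX dg] pderiv_on_mult[OF Rz dF dY] pg ..
  define G s A where "G = matrix_inv (g z)" and "s = 1 / sqrt (det (g z))"
    and "A b i = jacobian f (at z within R) $ b $ i" for b i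
  define \<Gamma> where "\<Gamma> = christoffel S g z"
  define \<Delta> where "\<Delta> = christoffel T h (f z)"
  have Gg: "G $ i $ 1 * gg k 1 z + G $ i $ 2 * gg k 2 z = (if i = k then s else 0)" for i k
  proof -
    have pos: "det (g z) > 0" and sym: "g z $ 2 $ 1 = g z $ 1 $ 2"
      using gram_matrix_pos gram_g zS by auto
    have "G ** g z = mat 1"
      unfolding G_def using pos by (simp add: matrix_inv_2 matrix_mult_scaleR_2 matrix_mult_adj2)
    then have "(G ** g z) $ i $ k = (if i = k then 1 else 0)" by (simp add: mat_def)
    moreover have "g z $ k $ j = g z $ j $ k" for j using gram_matrix_sym[OF gram_g[OF zS]] .
    ultimately have "(G $ i $ 1 * g z $ k $ 1 + G $ i $ 2 * g z $ k $ 2) * s = (if i = k then s else 0)"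
      by (simp add: matrix_mult_component_2)
    then show ?thesis by (simp add: gg_def s_def algebra_simps)
  qed
  have coclosed: "(\<Sum>i\<in>UNIV. \<Sum>j\<in>UNIV. G $ i $ j *
      (pderiv_on S i (gg k j) z - (\<Sum>l\<in>UNIV. \<Gamma> l i j * gg k l z))) = 0" for k
    unfolding gg_def G_def \<Gamma>_def using Sz g gram_g by (rule coclosed_coordinate_form)
  have divh: "pderiv_on T 1 (hh a 1) (f z) + pderiv_on T 2 (hh a 2) (f z) =
      - (\<Delta> a 1 1 * hh 1 1 (f z) + \<Delta> a 1 2 * hh 1 2 (f z) + (\<Delta> a 2 1 * hh 2 1 (f z) + \<Delta> a 2 2 * hh 2 2 (f z)))" for a
    using divergence_cofactor_density[of T "f z" h a, OF Tz h gram_h]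
    unfolding sum_2 hh_def \<Delta>_def by blast
  have pf: "pderiv_on R i f z $ b = A b i" for i b by (simp add: A_def jacobian_component)
  have cofz: "cof 1 1 z = A 2 2" "cof 1 2 z = - A 2 1" "cof 2 1 z = - A 1 2" "cof 2 2 z = A 1 1"
    by (simp_all add: cof_def A_def)
  have hsym: "hh 2 1 (f z) = hh 1 2 (f z)"
    using gram_matrix_pos(3)[OF gram_h[OF fz]] by (simp add: hh_def)
  have comp: "(\<Sum>i\<in>UNIV. \<Sum>j\<in>UNIV. G $ i $ j * covariant_deriv S g T h R f \<omega> z i j $ a) =
      s * (pderiv_on R 1 F z * Y a 1 z + pderiv_on R 2 F z * Y a 2 z)" for a
  proof -
    \<comment> \<open>\<open>V i k\<close> is the pull-back covariant derivative, in direction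
      \<open>i\<close>, of the vector-valued coefficient of \<open>gg k\<close>. The remaining terms
      of the Leibniz rule contain the coclosed expression for \<open>gg k\<close>.\<close>
    define V where "V i k = (pderiv_on R i F z * Y a k z + F z * pderiv_on R i (Y a k) z) +
      (\<Sum>b\<in>UNIV. \<Sum>c\<in>UNIV. \<Delta> a b c * A b i * (F z * Y c k z))" for i k
    have cov: "covariant_deriv S g T h R f \<omega> z i j $ a =
        (V i 1 * gg 1 j z + V i 2 * gg 2 j z)
        + F z * Y a 1 z * (pderiv_on S i (gg 1 j) z - (\<Sum>l\<in>UNIV. \<Gamma> l i j * gg 1 l z))
        + F z * Y a 2 z * (pderiv_on S i (gg 2 j) z - (\<Sum>l\<in>UNIV. \<Gamma> l i j * gg 2 l z))" for i j
      unfolding covariant_deriv_def vec_lambda_beta p\<omega> \<omega>c[OF z] pf V_def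
      by (simp add: sum_2 \<Gamma>_def[symmetric] \<Delta>_def[symmetric] algebra_simps)
    have "(\<Sum>i\<in>UNIV. \<Sum>j\<in>UNIV. G $ i $ j * covariant_deriv S g T h R f \<omega> z i j $ a) =
        (\<Sum>i\<in>UNIV. V i 1 * (G $ i $ 1 * gg 1 1 z + G $ i $ 2 * gg 1 2 z) +
                   V i 2 * (G $ i $ 1 * gg 2 1 z + G $ i $ 2 * gg 2 2 z))
        + F z * Y a 1 z * (\<Sum>i\<in>UNIV. \<Sum>j\<in>UNIV. G $ i $ j *
            (pderiv_on S i (gg 1 j) z - (\<Sum>l\<in>UNIV. \<Gamma> l i j * gg 1 l z)))
        + F z * Y a 2 z * (\<Sum>i\<in>UNIV. \<Sum>j\<in>UNIV. G $ i $ j *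
            (pderiv_on S i (gg 2 j) z - (\<Sum>l\<in>UNIV. \<Gamma> l i j * gg 2 l z)))"
      unfolding cov by (simp add: sum_2 algebra_simps)
    also have "\<dots> = s * (V 1 1 + V 2 2)" unfolding coclosed Gg by (simp add: sum_2 distrib_left mult.commute)
    \<comment> \<open>The Jacobian matrix times its cofactors is its determinant times the identity.
      The chain rule for \<open>hh\<close> and the target Christoffel term both acquire this factor,
      and their sum is the bracket that \<open>divh\<close> annihilates.\<close>
    also have "V 1 1 + V 2 2 = (pderiv_on R 1 F z * Y a 1 z + pderiv_on R 2 F z * Y a 2 z) +
      F z * ((A 1 1 * A 2 2 - A 1 2 * A 2 1) *
       ((pderiv_on T 1 (hh a 1) (f z) + pderiv_on T 2 (hh a 2) (f z)) +
        (\<Delta> a 1 1 * hh 1 1 (f z) + \<Delta> a 1 2 * hh 1 2 (f z) + (\<Delta> a 2 1 * hh 2 1 (f z) + \<Delta> a 2 2 * hh 2 2 (f z))))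
       + hh a 1 (f z) * (pderiv_on R 1 (cof 1 1) z + pderiv_on R 2 (cof 1 2) z)
       + hh a 2 (f z) * (pderiv_on R 1 (cof 2 1) z + pderiv_on R 2 (cof 2 2) z))"
      unfolding V_def pY ph pf
      by (simp add: Y_def cofz sum_2 hsym algebra_simps)
    also have "\<dots> = pderiv_on R 1 F z * Y a 1 z + pderiv_on R 2 F z * Y a 2 z"
      unfolding divcof divh by simp
    finally show ?thesis .
  qed
  show "codifferential S g T h R f \<omega> z =
      - (1 / (sqrt (det (g z)) * sqrt (det (h (f z))))) *\<^sub>R
        ((adj2 (h (f z)) ** transpose (adj2 (jacobian f (at z within R)))) *v (\<chi> i. pderiv_on R i F z))"
  proof (unfold vec_eq_iff, rule allI)
    fix a
    have "codifferential S g T h R f \<omega> z $ a =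
        - (\<Sum>i\<in>UNIV. \<Sum>j\<in>UNIV. G $ i $ j * covariant_deriv S g T h R f \<omega> z i j $ a)"
      unfolding codifferential_eq[of g z, OF gram_g[OF zS]] G_def by (simp add: sum_2)
    also have "\<dots> = - (s * (pderiv_on R 1 F z * Y a 1 z + pderiv_on R 2 F z * Y a 2 z))"
      unfolding comp ..
    also have "\<dots> = (- (1 / (sqrt (det (g z)) * sqrt (det (h (f z))))) *\<^sub>R
        ((adj2 (h (f z)) ** transpose (adj2 (jacobian f (at z within R)))) *v (\<chi> i. pderiv_on R i F z))) $ a"
      by (simp add: s_def Y_def hh_def cof_def matrix_vector_mult_def matrix_mult_component_2 sum_2
          divide_inverse algebra_simps)
    finally show "codifferential S g T h R f \<omega> z $ a = \<dots>" .
  qed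
qed

section \<open>Independence of charts and constancy of the Jacobian\<close>

lemma chart_inv_apply:
  assumes "is_chart X c" "x \<in> fst c"
  shows "chart_inv c (snd c x) = x"
proof -
  have "fst c \<subseteq> topspace X" "homeomorphic_map (subtopology X (fst c)) (top_of_set (snd c ` fst c)) (snd c)"
    using assms(1) openin_subset unfolding is_chart_def by auto
  then have "inj_on (snd c) (fst c)"
    by (metis homeomorphic_imp_injective_map topspace_subtopology_subset)
  then show ?thesis unfolding chart_inv_def using assms(2) by (rule inv_into_f_f)
qed

lemma chart_image_openin:
  assumes c: "is_chart X c" and U: "openin X U" "U \<subseteq> fst c"
  shows "openin (top_of_set (snd c ` fst c)) (snd c ` U)"
proof -
  have "homeomorphic_map (subtopology X (fst c)) (top_of_set (snd c ` fst c)) (snd c)"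
    using c unfolding is_chart_def by auto
  moreover have "openin (subtopology X (fst c)) U"
    using U openin_subtopology by blast
  ultimately show ?thesis
    by (meson homeomorphic_imp_open_map open_map_def)
qed

lemma lipschitz_region_chart_image:
  assumes "is_chart X c" "openin X U" "U \<subseteq> fst c"
  shows "lipschitz_region (snd c ` U)"
  using lipschitz_region_openin[OF _ chart_image_openin[OF assms]] assms(1) unfolding is_chart_def by blast

lemma chart_preimage_openin:
  assumes c: "is_chart X c" and B: "open B"
  shows "openin X {y \<in> fst c. snd c y \<in> B}"
proof -
  have op: "openin X (fst c)" and
    h: "homeomorphic_map (subtopology X (fst c)) (top_of_set (snd c ` fst c)) (snd c)"
    using c by (simp_all add: is_chart_def)
  have ts: "topspace (subtopology X (fst c)) = fst c"
    using openin_subset[OF op] by (rule topspace_subtopology_subset)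
  have "openin (top_of_set (snd c ` fst c)) (snd c ` fst c \<inter> B)"
    using B by (rule openin_open_Int)
  from openin_continuous_map_preimage[OF homeomorphic_imp_continuous_map[OF h] this]
  have "openin (subtopology X (fst c)) {y \<in> fst c. snd c y \<in> snd c ` fst c \<inter> B}"
    unfolding ts .
  then have "openin X {y \<in> fst c. snd c y \<in> snd c ` fst c \<inter> B}"
    using op by (rule openin_trans_full)
  moreover have "{y \<in> fst c. snd c y \<in> snd c ` fst c \<inter> B} = {y \<in> fst c. snd c y \<in> B}" by blast
  ultimately show ?thesis by simp
qed

lemma det_adj2: "det (adj2 A) = det A"
  by (simp add: det_2)

lemma matrix_vector_mult_eq_0_iff:
  fixes A :: "real^'n^'n"
  assumes "det A \<noteq> 0"
  shows "A *v x = 0 \<longleftrightarrow> x = 0"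
  using assms by (metis invertible_det_nz invertible_left_inverse matrix_left_invertible_ker matrix_vector_mult_0_right)

lemma smooth_on_imp_differentiable_on: "smooth_on f S \<Longrightarrow> f differentiable_on S"
  unfolding smooth_on_def by (drule spec[of _ "Suc 0"]) simp

text \<open>Local constancy makes every set defined by the value of \<open>f\<close> open, so a
  level set and its complement are both open.\<close>

lemma connected_space_locally_constant:
  assumes "connected_space X" "x \<in> topspace X" "y \<in> topspace X"
    and loc: "\<And>x. x \<in> topspace X \<Longrightarrow> \<exists>U. openin X U \<and> x \<in> U \<and> (\<forall>y\<in>U. f y = f x)"
  shows "f x = f y"
proof -
  have op: "openin X {y \<in> topspace X. P (f y)}" for P
  proof (rule openin_subopen[THEN iffD2], rule ballI)
    fix w assume w: "w \<in> {y \<in> topspace X. P (f y)}"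
    then have "w \<in> topspace X" by simp
    from loc[OF this] obtain U where U: "openin X U" "w \<in> U" "\<forall>y\<in>U. f y = f w" by blast
    have "U \<subseteq> {y \<in> topspace X. P (f y)}"
    proof
      fix y assume "y \<in> U"
      then show "y \<in> {y \<in> topspace X. P (f y)}" using openin_subset[OF U(1)] U(3) w by auto
    qed
    with U show "\<exists>T. openin X T \<and> w \<in> T \<and> T \<subseteq> {y \<in> topspace X. P (f y)}" by blast
  qed
  let ?C = "{w \<in> topspace X. f w = f x}"
  have "topspace X - ?C = {w \<in> topspace X. f w \<noteq> f x}" by auto
  then have "openin X (topspace X - ?C)" using op[of "\<lambda>v. v \<noteq> f x"] by (simp only:)
  then have "closedin X ?C" by (simp add: closedin_def)
  with op[of "\<lambda>v. v = f x"] have "?C = {} \<or> ?C = topspace X"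
    using assms(1) by (simp only: connected_space_clopen_in)
  moreover have "x \<in> ?C" using assms(2) by simp
  ultimately have "y \<in> ?C" using assms(3) by auto
  then show ?thesis by simp
qed

lemma surface_chart:
  assumes S: "oriented_riemannian_surface S" and c: "c \<in> charts S"
  shows "is_chart (topo S) c" "lipschitz_region (snd c ` fst c)"
    "metric S c differentiable_on snd c ` fst c" "\<And>z. z \<in> snd c ` fst c \<Longrightarrow> gram_matrix (metric S c z)"
proof -
  have A: "oriented_smooth_atlas (topo S) (charts S)" and R: "riemannian_metric (charts S) (metric S)"
    using S by (simp_all add: oriented_riemannian_surface_def)
  show ch: "is_chart (topo S) c" using A c by (simp add: oriented_smooth_atlas_def)
  then show "lipschitz_region (snd c ` fst c)" by (simp add: is_chart_def)
  have "smooth_on (metric S c) (snd c ` fst c)" and g: "\<forall>z\<in>snd c ` fst c. gram_matrix (metric S c z)"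
    using conjunct1[OF R[unfolded riemannian_metric_def]] c by blast+
  then show "metric S c differentiable_on snd c ` fst c" by (intro smooth_on_imp_differentiable_on)
  show "gram_matrix (metric S c z)" if "z \<in> snd c ` fst c" for z using g that by (rule bspec)
qed

lemma surface_transition:
  assumes S: "oriented_riemannian_surface S" and c: "c \<in> charts S" "c' \<in> charts S"
  shows "smooth_on (transition c c') (overlap c c')"
    and "z \<in> overlap c c' \<Longrightarrow> det (jacobian (transition c c') (at z within overlap c c')) > 0"
    and "z \<in> overlap c c' \<Longrightarrow> metric S c z =
      transpose (jacobian (transition c c') (at z within overlap c c')) **
      metric S c' (transition c c' z) ** jacobian (transition c c') (at z within overlap c c')"
proof -
  have A: "oriented_smooth_atlas (topo S) (charts S)" and R: "riemannian_metric (charts S) (metric S)"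
    using S by (simp_all add: oriented_riemannian_surface_def)
  have "\<forall>c\<in>charts S. \<forall>d\<in>charts S. smooth_on (transition c d) (overlap c d) \<and>
        (\<forall>z\<in>overlap c d. det (jacobian (transition c d) (at z within overlap c d)) > 0)"
    using A by (simp add: oriented_smooth_atlas_def)
  from bspec[OF bspec[OF this c(1)] c(2)]
  show "smooth_on (transition c c') (overlap c c')"
    and "z \<in> overlap c c' \<Longrightarrow> det (jacobian (transition c c') (at z within overlap c c')) > 0"
    by simp_all
  from bspec[OF bspec[OF conjunct2[OF R[unfolded riemannian_metric_def Let_def]] c(1)] c(2)]
  show "z \<in> overlap c c' \<Longrightarrow> metric S c z =
      transpose (jacobian (transition c c') (at z within overlap c c')) **
      metric S c' (transition c c' z) ** jacobian (transition c c') (at z within overlap c c')"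
    by (rule bspec)
qed

lemma transition_apply:
  assumes "is_chart X c" "x \<in> fst c"
  shows "transition c c' (snd c x) = snd c' x"
  by (simp add: transition_def chart_inv_apply[OF assms])

text \<open>The determinant of a metric transforms with the square of \<open>det D\<close>; since
  the atlas is oriented, the volume density transforms with \<open>det D\<close> itself.\<close>

lemma transition_metric:
  assumes S: "oriented_riemannian_surface S" and c: "c \<in> charts S" "c' \<in> charts S"
    and x: "x \<in> fst c" "x \<in> fst c'"
  obtains D where "(transition c c' has_derivative (\<lambda>h. D *v h)) (at (snd c x) within overlap c c')"
    "det D > 0" "sqrt (det (metric S c (snd c x))) = det D * sqrt (det (metric S c' (snd c' x)))"
proof -
  define D where "D = jacobian (transition c c') (at (snd c x) within overlap c c')"
  have ov: "snd c x \<in> overlap c c'" using x by (auto simp: overlap_def)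
  have ch: "is_chart (topo S) c"
    using surface_chart(1)[OF S c(1)] .
  have "smooth_on (transition c c') (overlap c c')" and D: "det D > 0"
    using surface_transition(1)[OF S c] surface_transition(2)[OF S c ov] unfolding D_def .
  then have "transition c c' differentiable (at (snd c x) within overlap c c')"
    using smooth_on_imp_differentiable_on ov unfolding differentiable_on_def by blast
  then have 1: "(transition c c' has_derivative (\<lambda>h. D *v h)) (at (snd c x) within overlap c c')"
    unfolding D_def by (simp add: jacobian_works)
  have "metric S c (snd c x) = transpose D ** metric S c' (transition c c' (snd c x)) ** D"
    using surface_transition(3)[OF S c ov] unfolding D_def .
  then have "det (metric S c (snd c x)) = (det D)\<^sup>2 * det (metric S c' (snd c' x))"
    by (simp add: det_mul det_transpose transition_apply[OF ch x(1)] power2_eq_square)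
  then have "sqrt (det (metric S c (snd c x))) = det D * sqrt (det (metric S c' (snd c' x)))"
    using D by (simp add: real_sqrt_mult)
  with 1 D show ?thesis by (rule that)
qed

section \<open>The Euler-Lagrange equation in a pair of charts\<close>

locale K_map =
  fixes M :: "'a surface" and N :: "'b surface" and \<phi> :: "'a \<Rightarrow> 'b"
  assumes M: "oriented_riemannian_surface M" and N: "oriented_riemannian_surface N"
    and C2: "C2_map M N \<phi>"
    and pos: "differential_satisfies M N \<phi> (\<lambda>G H A. metric_det G H A > 0)"
    and K: "differential_satisfies M N \<phi> (\<lambda>G H A. A \<in> K_set G H)"
begin

definition J :: "'a chart \<Rightarrow> 'b chart \<Rightarrow> real^2 \<Rightarrow> real" where
  "J c d z = metric_det (metric M c z) (metric N d (local_rep c d \<phi> z)) (local_differential c d \<phi> z)"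

lemmas chart_M = surface_chart(1)[OF M] and region_M = surface_chart(2)[OF M]
  and metric_M = surface_chart(3)[OF M] and gram_M = surface_chart(4)[OF M]
  and chart_N = surface_chart(1)[OF N] and region_N = surface_chart(2)[OF N]
  and metric_N = surface_chart(3)[OF N] and gram_N = surface_chart(4)[OF N]

lemma preimage_openin:
  assumes "openin (topo M) U" "openin (topo N) V"
  shows "openin (topo M) {x \<in> U. \<phi> x \<in> V}"
proof -
  have "openin (topo M) {x \<in> topspace (topo M). \<phi> x \<in> V}"
    using C2 assms(2) unfolding C2_map_def by (blast intro: openin_continuous_map_preimage)
  then have "openin (topo M) (U \<inter> {x \<in> topspace (topo M). \<phi> x \<in> V})"
    using assms(1) by (rule openin_Int[rotated])
  moreover have "U \<inter> {x \<in> topspace (topo M). \<phi> x \<in> V} = {x \<in> U. \<phi> x \<in> V}"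
    using openin_subset[OF assms(1)] by blast
  ultimately show ?thesis by simp
qed

lemma local_rep_apply:
  assumes "c \<in> charts M" "x \<in> fst c"
  shows "local_rep c d \<phi> (snd c x) = snd d (\<phi> x)"
  by (simp add: local_rep_def chart_inv_apply[OF chart_M[OF assms(1)] assms(2)])

context
  fixes c d assumes c: "c \<in> charts M" and d: "d \<in> charts N"
begin

lemma local_dom_openin: "openin (top_of_set (snd c ` fst c)) (local_dom c d \<phi>)"
proof -
  have "openin (topo M) (fst c)" "openin (topo N) (fst d)"
    using chart_M[OF c] chart_N[OF d] by (auto simp: is_chart_def)
  from chart_image_openin[OF chart_M[OF c] preimage_openin[OF this]]
  show ?thesis unfolding local_dom_def by auto
qed

lemma local_dom_region: "lipschitz_region (local_dom c d \<phi>)"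
  using lipschitz_region_openin[OF region_M[OF c] local_dom_openin] .

lemma local_dom_subset: "local_dom c d \<phi> \<subseteq> snd c ` fst c"
  by (auto simp: local_dom_def)

lemma local_rep_image: "local_rep c d \<phi> ` local_dom c d \<phi> \<subseteq> snd d ` fst d"
  by (auto simp: local_dom_def local_rep_apply[OF c])

lemma local_rep_Ck: "Ck_on 2 (local_rep c d \<phi>) (local_dom c d \<phi>)"
  using C2 c d by (simp add: C2_map_def)

lemma local_gram:
  assumes "z \<in> local_dom c d \<phi>"
  shows "gram_matrix (metric M c z)" "gram_matrix (metric N d (local_rep c d \<phi> z))"
  using gram_M[OF c] gram_N[OF d] assms local_dom_subset local_rep_image by blast+

lemma local_K:
  assumes "z \<in> local_dom c d \<phi>"
  shows "local_differential c d \<phi> z \<in> K_set (metric M c z) (metric N d (local_rep c d \<phi> z))"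
    and "J c d z > 0"
  using pos K c d assms by (simp_all add: differential_satisfies_def J_def)

lemma J_le: "z \<in> local_dom c d \<phi> \<Longrightarrow> J c d z \<le> 1 / 4"
  unfolding J_def by (intro K_set_polar(3) local_gram local_K)

lemma J_differentiable:
  assumes z: "z \<in> local_dom c d \<phi>"
  shows "J c d differentiable (at z within local_dom c d \<phi>)"
proof -
  let ?R = "local_dom c d \<phi>" and ?f = "local_rep c d \<phi>"
  have zS: "z \<in> snd c ` fst c" using z local_dom_subset by blast
  have fz: "?f z \<in> snd d ` fst d" using z local_rep_image by blast
  note f = local_rep_Ck
  have df: "?f differentiable (at z within ?R)" using Ck_on_2D(1)[OF f] z by (simp add: differentiable_on_def)
  have dA: "(\<lambda>y. local_differential c d \<phi> y $ a $ i) differentiable (at z within ?R)" for a i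
    unfolding local_differential_def jacobian_component
    using Ck_on_2D(2)[OF f] z by (intro differentiable_vec_nth) (simp add: differentiable_on_def)
  have 1: "(\<lambda>y. det (local_differential c d \<phi> y)) differentiable (at z within ?R)"
    unfolding det_2 by (intro differentiable_diff differentiable_mult dA)
  have "(\<lambda>w. det (metric N d w)) differentiable (at (?f z) within snd d ` fst d)"
    using region_N[OF d] fz metric_N[OF d] gram_N[OF d] by (rule christoffel_contract_det(1))
  from pderiv_on_compose(1)[OF local_dom_region z df local_rep_image this]
  have 2: "(\<lambda>y. sqrt (det (metric N d (?f y)))) differentiable (at z within ?R)"
    by (rule differentiable_real_compose[OF _ DERIV_real_sqrt])
       (rule gram_matrix_pos(2)[OF local_gram(2)[OF z]])
  have "(\<lambda>y. 1 / sqrt (det (metric M c y))) differentiable (at z within snd c ` fst c)"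
    using region_M[OF c] zS metric_M[OF c] gram_M[OF c] by (rule pderiv_on_div_sqrt_det(1)) auto
  then have 3: "(\<lambda>y. 1 / sqrt (det (metric M c y))) differentiable (at z within ?R)"
    using local_dom_subset differentiable_within_subset by blast
  have "J c d = (\<lambda>y. sqrt (det (metric N d (?f y))) * det (local_differential c d \<phi> y) * (1 / sqrt (det (metric M c y))))"
    by (simp add: J_def metric_det_def fun_eq_iff)
  then show ?thesis by (simp only: differentiable_mult[OF differentiable_mult[OF 2 1] 3])
qed

lemma EL_form_eq:
  assumes z: "z \<in> local_dom c d \<phi>"
  shows "EL_form p M N \<phi> c d z = (- ((1 - 2 * J c d z) powr ((p - 2) / 2))) *\<^sub>R
    metric_cofactor (metric M c z) (metric N d (local_rep c d \<phi> z)) (local_differential c d \<phi> z)"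
proof -
  note polar = K_set_polar[OF local_gram[OF z] local_K(1)[OF z]]
  have "sqrt (1 - 2 * J c d z) = (1 - 2 * J c d z) powr (1 / 2)"
    using J_le[OF z] by (simp add: powr_half_sqrt)
  then have "sqrt (1 - 2 * J c d z) powr (p - 2) = (1 - 2 * J c d z) powr ((p - 2) / 2)"
    by (simp add: powr_powr)
  then show ?thesis unfolding EL_form_def Let_def polar(1,2) J_def[symmetric] by simp
qed

text \<open>By \<open>J_le\<close> the base of the power is at least 1/2, so the scalar factor is
  differentiable for every exponent, and the derivative of the power vanishes only for
  \<open>p = 2\<close>.\<close>

lemma EL_form_codifferential:
  assumes z: "z \<in> local_dom c d \<phi>"
  shows "EL_form p M N \<phi> c d differentiable (at z within local_dom c d \<phi>)"
    and "codifferential (snd c ` fst c) (metric M c) (snd d ` fst d) (metric N d)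
          (local_dom c d \<phi>) (local_rep c d \<phi>) (EL_form p M N \<phi> c d) z = 0 \<longleftrightarrow>
        p = 2 \<or> (\<forall>i. pderiv_on (local_dom c d \<phi>) i (J c d) z = 0)"
proof -
  let ?R = "local_dom c d \<phi>" and ?f = "local_rep c d \<phi>"
  let ?F = "\<lambda>y. - ((1 - 2 * J c d y) powr ((p - 2) / 2))"
  \<comment> \<open>The outer minus sign, the inner derivative -2 and the halved exponent combine to
    the factor \<open>p - 2\<close>.\<close>
  have k: "((\<lambda>x. - ((1 - 2 * x) powr ((p - 2) / 2))) has_real_derivative
      (p - 2) * (1 - 2 * J c d y) powr ((p - 2) / 2 - 1)) (at (J c d y))" if "y \<in> ?R" for y
    using J_le[OF that] by (auto intro!: derivative_eq_intros simp: field_simps)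
  have F: "?F differentiable_on ?R"
    unfolding differentiable_on_def using differentiable_real_compose[OF J_differentiable k] by blast
  note cof = cofactor_form[where F = ?F and \<omega> = "EL_form p M N \<phi> c d", OF region_M[OF c] metric_M[OF c] gram_M[OF c] region_N[OF d] metric_N[OF d]
      gram_N[OF d] local_dom_openin local_rep_image local_rep_Ck F
      EL_form_eq[unfolded local_differential_def] z]
  show "EL_form p M N \<phi> c d differentiable (at z within ?R)" by (rule cof(1))
  let ?G = "metric M c z" and ?H = "metric N d (?f z)" and ?A = "jacobian ?f (at z within ?R)"
  have GH: "det ?G > 0" "det ?H > 0" using local_gram[OF z] gram_matrix_pos by auto
  \<comment> \<open>Positivity of the Jacobian makes the cofactor map injective, so the
    codifferential vanishes exactly when the gradient of the scalar factor does.\<close>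
  have "det ?A \<noteq> 0" using local_K(2)[OF z] by (auto simp: J_def metric_det_def local_differential_def)
  then have det: "det (adj2 ?H ** transpose (adj2 ?A)) \<noteq> 0"
    using GH by (simp add: det_mul det_adj2 det_transpose)
  have codiff: "codifferential (snd c ` fst c) (metric M c) (snd d ` fst d) (metric N d)
          ?R ?f (EL_form p M N \<phi> c d) z =
      - (1 / (sqrt (det ?G) * sqrt (det ?H))) *\<^sub>R
        ((adj2 ?H ** transpose (adj2 ?A)) *v (\<chi> i. pderiv_on ?R i ?F z))"
    by (rule cof(2))
  have "codifferential (snd c ` fst c) (metric M c) (snd d ` fst d) (metric N d)
          ?R ?f (EL_form p M N \<phi> c d) z = 0 \<longleftrightarrow> (\<chi> i. pderiv_on ?R i ?F z) = 0"
    unfolding codiff using GH matrix_vector_mult_eq_0_iff[OF det] by simp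
  also have "\<dots> \<longleftrightarrow> (\<forall>i. pderiv_on ?R i ?F z = 0)" by (simp add: vec_eq_iff)
  also have "\<dots> \<longleftrightarrow> (\<forall>i. (p - 2) * (1 - 2 * J c d z) powr ((p - 2) / 2 - 1) * pderiv_on ?R i (J c d) z = 0)"
    unfolding pderiv_on_real_compose[OF local_dom_region z J_differentiable[OF z] k[OF z]] ..
  also have "\<dots> \<longleftrightarrow> p = 2 \<or> (\<forall>i. pderiv_on ?R i (J c d) z = 0)"
    using J_le[OF z] by auto
  finally show "codifferential (snd c ` fst c) (metric M c) (snd d ` fst d) (metric N d)
          ?R ?f (EL_form p M N \<phi> c d) z = 0 \<longleftrightarrow> p = 2 \<or> (\<forall>i. pderiv_on ?R i (J c d) z = 0)" .
qed

end

section \<open>From coordinates to the whole surface\<close>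

lemma critical_point_iff:
  "critical_point p M N \<phi> \<longleftrightarrow> p = 2 \<or> (\<forall>c\<in>charts M. \<forall>d\<in>charts N. \<forall>z\<in>local_dom c d \<phi>. \<forall>i.
     pderiv_on (local_dom c d \<phi>) i (J c d) z = 0)"
  unfolding critical_point_def differentiable_on_def
  using EL_form_codifferential by blast

text \<open>The chain rule gives \<open>A = D2 ** A' ** D1\<close> with the derivatives of the
  transitions, whose determinants cancel against the changes of the two volume densities.\<close>

lemma J_chart_independent:
  assumes c: "c \<in> charts M" "c' \<in> charts M" and d: "d \<in> charts N" "d' \<in> charts N"
    and x: "x \<in> fst c" "x \<in> fst c'" "\<phi> x \<in> fst d" "\<phi> x \<in> fst d'"
  shows "J c d (snd c x) = J c' d' (snd c' x)"
proof -
  let ?f = "local_rep c d \<phi>" and ?f' = "local_rep c' d' \<phi>"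
  let ?z = "snd c x" and ?z' = "snd c' x"
  note ch = chart_M[OF c(1)] chart_M[OF c(2)] chart_N[OF d(1)] chart_N[OF d(2)]
  \<comment> \<open>The four maps involved are differentiated relative to different regions.
    Restricting them to the coordinate images of a common open set makes uniqueness of derivatives
    applicable.\<close>
  define U where "U = {y \<in> fst c \<inter> fst c'. \<phi> y \<in> fst d \<inter> fst d'}"
  define W where "W = snd c ` U"
  have "openin (topo M) U" unfolding U_def
    using ch by (intro preimage_openin openin_Int) (auto simp: is_chart_def)
  then have W: "lipschitz_region W" unfolding W_def
    using ch(1) by (intro lipschitz_region_chart_image) (auto simp: U_def)
  have zW: "?z \<in> W" using x by (auto simp: W_def U_def)
  obtain D1 where D1: "(transition c c' has_derivative (\<lambda>h. D1 *v h)) (at ?z within overlap c c')"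
    "det D1 > 0" "sqrt (det (metric M c ?z)) = det D1 * sqrt (det (metric M c' ?z'))"
    using transition_metric[OF M c x(1,2)] .
  obtain D2 where D2: "(transition d' d has_derivative (\<lambda>h. D2 *v h)) (at (snd d' (\<phi> x)) within overlap d' d)"
    "det D2 > 0" "sqrt (det (metric N d' (snd d' (\<phi> x)))) = det D2 * sqrt (det (metric N d (snd d (\<phi> x))))"
    using transition_metric[OF N d(2,1) x(4,3)] .
  define A A' where "A = local_differential c d \<phi> ?z" and "A' = local_differential c' d' \<phi> ?z'"
  have jac: "(local_rep c d \<phi> has_derivative (\<lambda>h. local_differential c d \<phi> w *v h)) (at w within local_dom c d \<phi>)"
    if "c \<in> charts M" "d \<in> charts N" "w \<in> local_dom c d \<phi>" for c d w
    using Ck_on_2D(1)[OF local_rep_Ck[OF that(1,2)]] that(3)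
    unfolding differentiable_on_def local_differential_def jacobian_works by blast
  have A: "(?f has_derivative (\<lambda>h. A *v h)) (at ?z within W)"
    unfolding A_def
    by (rule has_derivative_subset[OF jac[OF c(1) d(1)]]) (use x in \<open>auto simp: W_def U_def local_dom_def\<close>)
  have t1: "(transition c c' has_derivative (\<lambda>h. D1 *v h)) (at ?z within W)"
    by (rule has_derivative_subset[OF D1(1)]) (auto simp: W_def U_def overlap_def)
  have t1z: "transition c c' ?z = ?z'" using transition_apply[OF ch(1) x(1)] .
  have im1: "transition c c' ` W = snd c' ` U"
    unfolding W_def image_image
    by (rule image_cong[OF refl]) (simp add: U_def transition_apply[OF ch(1)])
  have "(?f' has_derivative (\<lambda>h. A' *v h)) (at ?z' within snd c' ` U)"
    unfolding A'_def
    by (rule has_derivative_subset[OF jac[OF c(2) d(2)]]) (use x in \<open>auto simp: U_def local_dom_def\<close>)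
  then have f': "(?f' has_derivative (\<lambda>h. A' *v h)) (at (transition c c' ?z) within transition c c' ` W)"
    unfolding t1z im1 .
  have g: "((?f' \<circ> transition c c') has_derivative (\<lambda>h. A' *v h) \<circ> (\<lambda>h. D1 *v h)) (at ?z within W)"
    by (rule diff_chain_within[OF t1 f'])
  have gz: "(?f' \<circ> transition c c') (snd c y) = snd d' (\<phi> y)" if "y \<in> U" for y
    using that by (simp add: U_def transition_apply[OF ch(1)] local_rep_apply[OF c(2)])
  have im2: "(?f' \<circ> transition c c') ` W \<subseteq> overlap d' d"
  proof
    fix w assume "w \<in> (?f' \<circ> transition c c') ` W"
    then obtain y where y: "y \<in> U" "w = (?f' \<circ> transition c c') (snd c y)" unfolding W_def by blast
    show "w \<in> overlap d' d" unfolding y(2) gz[OF y(1)] overlap_def using y(1) by (auto simp: U_def)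
  qed
  have xU: "x \<in> U" using x by (simp add: U_def)
  have "(transition d' d has_derivative (\<lambda>h. D2 *v h))
      (at ((?f' \<circ> transition c c') ?z) within (?f' \<circ> transition c c') ` W)"
    unfolding gz[OF xU] by (rule has_derivative_subset[OF D2(1) im2])
  from diff_chain_within[OF g this]
  have comp: "((transition d' d \<circ> (?f' \<circ> transition c c')) has_derivative
      (\<lambda>h. D2 *v h) \<circ> ((\<lambda>h. A' *v h) \<circ> (\<lambda>h. D1 *v h))) (at ?z within W)" .
  have eq: "?f w = (transition d' d \<circ> (?f' \<circ> transition c c')) w" if w: "w \<in> W" for w
  proof -
    obtain y where y: "y \<in> U" "w = snd c y" using w unfolding W_def by blast
    have yy: "y \<in> fst c" "\<phi> y \<in> fst d'" using y(1) by (auto simp: U_def)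
    show ?thesis unfolding y(2) local_rep_apply[OF c(1) yy(1)]
      using gz[OF y(1)] transition_apply[OF ch(4) yy(2)] by simp
  qed
  from has_derivative_unique_lipschitz_region[OF W zW A has_derivative_transform[OF zW eq comp]]
  have "(\<lambda>h. A *v h) = (\<lambda>h. D2 *v h) \<circ> ((\<lambda>h. A' *v h) \<circ> (\<lambda>h. D1 *v h))" .
  then have "A *v h = (D2 ** A' ** D1) *v h" for h
    by (simp add: fun_eq_iff matrix_vector_mul_assoc matrix_mul_assoc)
  then have "A = D2 ** A' ** D1" by (simp add: matrix_eq)
  then have "det A = det D2 * det A' * det D1" by (simp add: det_mul)
  then show ?thesis
    unfolding J_def metric_det_def A_def[symmetric] A'_def[symmetric]
      local_rep_apply[OF c(1) x(1)] local_rep_apply[OF c(2) x(2)] D1(3) D2(3)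
    using D1(2) by (simp add: divide_simps)
qed

text \<open>In a pair of charts a zero gradient gives local constancy, up to the boundary. The
  passage to global constancy takes place on \<open>M\<close>, since a coordinate domain
  \<open>local_dom c d \<phi>\<close> may be disconnected.\<close>

lemma J_constant:
  assumes conn: "connected_space (topo M)"
    and zero: "\<And>c d z i. c \<in> charts M \<Longrightarrow> d \<in> charts N \<Longrightarrow> z \<in> local_dom c d \<phi> \<Longrightarrow>
      pderiv_on (local_dom c d \<phi>) i (J c d) z = 0"
  obtains j where "\<And>c d z. c \<in> charts M \<Longrightarrow> d \<in> charts N \<Longrightarrow> z \<in> local_dom c d \<phi> \<Longrightarrow> J c d z = j"
proof -
  have "\<forall>x\<in>topspace (topo M). \<exists>c d. c \<in> charts M \<and> d \<in> charts N \<and> x \<in> fst c \<and> \<phi> x \<in> fst d"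
  proof
    fix x assume x: "x \<in> topspace (topo M)"
    have "continuous_map (topo M) (topo N) \<phi>" using C2 by (simp add: C2_map_def)
    then have y: "\<phi> x \<in> topspace (topo N)" using x by (auto simp: continuous_map_def Pi_iff)
    have "(\<Union>c\<in>charts M. fst c) = topspace (topo M)" "(\<Union>d\<in>charts N. fst d) = topspace (topo N)"
      using M N by (simp_all add: oriented_riemannian_surface_def oriented_smooth_atlas_def)
    with x y have "x \<in> (\<Union>c\<in>charts M. fst c)" "\<phi> x \<in> (\<Union>d\<in>charts N. fst d)" by simp_all
    then show "\<exists>c d. c \<in> charts M \<and> d \<in> charts N \<and> x \<in> fst c \<and> \<phi> x \<in> fst d" by blast
  qed
  then obtain cc dd where ccdd: "\<And>x. x \<in> topspace (topo M) \<Longrightarrow>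
      cc x \<in> charts M \<and> dd x \<in> charts N \<and> x \<in> fst (cc x) \<and> \<phi> x \<in> fst (dd x)"
    by metis
  \<comment> \<open>An arbitrary choice of charts at each point; chart independence makes
    \<open>Jp\<close> the coordinate-free Jacobian, which every \<open>J c d\<close>
    represents.\<close>
  define Jp where "Jp x = J (cc x) (dd x) (snd (cc x) x)" for x
  have ts: "fst c \<subseteq> topspace (topo M)" if "c \<in> charts M" for c
    using chart_M[OF that] by (simp add: is_chart_def openin_subset)
  have Jp: "J c d (snd c x) = Jp x"
    if "c \<in> charts M" "d \<in> charts N" "x \<in> fst c" "\<phi> x \<in> fst d" for c d x
    unfolding Jp_def using that ts ccdd[of x] by (intro J_chart_independent) blast+
  have loc: "\<exists>U. openin (topo M) U \<and> x \<in> U \<and> (\<forall>y\<in>U. Jp y = Jp x)" if x: "x \<in> topspace (topo M)" for x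
  proof -
    define c d where "c = cc x" and "d = dd x"
    have cd: "c \<in> charts M" "d \<in> charts N" "x \<in> fst c" "\<phi> x \<in> fst d"
      using ccdd[OF x] by (auto simp: c_def d_def)
    let ?R = "local_dom c d \<phi>"
    have z: "snd c x \<in> ?R" using cd by (auto simp: local_dom_def)
    have "(J c d has_derivative (\<lambda>_. 0)) (at y within ?R)" if y: "y \<in> ?R" for y
    proof -
      let ?D = "frechet_derivative (J c d) (at y within ?R)"
      have D: "(J c d has_derivative ?D) (at y within ?R)"
        using J_differentiable[OF cd(1,2) y] by (simp add: frechet_derivative_works)
      have "?D v = 0" for v
        using linear_expand_2[OF has_derivative_linear[OF D], of v] zero[OF cd(1,2) y]
        by (simp add: pderiv_on_def)
      then have "?D = (\<lambda>_. 0)" by (simp add: fun_eq_iff)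
      with D show ?thesis by simp
    qed
    from lipschitz_region_locally_constant[OF local_dom_region[OF cd(1,2)] z this]
    obtain e where e: "e > 0" "\<And>y. y \<in> ?R \<Longrightarrow> dist (snd c x) y < e \<Longrightarrow> J c d y = J c d (snd c x)"
      by blast
    let ?U = "{y \<in> {y \<in> fst c. snd c y \<in> ball (snd c x) e}. \<phi> y \<in> fst d}"
    have "openin (topo N) (fst d)" using chart_N[OF cd(2)] by (simp add: is_chart_def)
    then have "openin (topo M) ?U"
      by (intro preimage_openin chart_preimage_openin chart_M cd) auto
    moreover have "x \<in> ?U" using cd e by simp
    moreover have "Jp y = Jp x" if y: "y \<in> ?U" for y
    proof -
      have "snd c y \<in> ?R" using y by (auto simp: local_dom_def)
      then have "J c d (snd c y) = J c d (snd c x)" using y by (intro e) auto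
      then show ?thesis using Jp[OF cd(1,2)] y cd by auto
    qed
    ultimately show ?thesis by blast
  qed
  show ?thesis
  \<comment> \<open>The value at an arbitrary base point. Its existence matters only once a point
    \<open>z\<close> is given, and then \<open>M\<close> is non-empty.\<close>
  proof (rule that[of "Jp (SOME x. x \<in> topspace (topo M))"])
    fix c d z assume a: "c \<in> charts M" "d \<in> charts N" "z \<in> local_dom c d \<phi>"
    then obtain x where x: "x \<in> fst c" "\<phi> x \<in> fst d" "z = snd c x" by (auto simp: local_dom_def)
    have xt: "x \<in> topspace (topo M)" using ts a x by blast
    then have "(SOME x. x \<in> topspace (topo M)) \<in> topspace (topo M)" by (rule someI)
    from connected_space_locally_constant[OF conn xt this loc]
    show "J c d z = Jp (SOME x. x \<in> topspace (topo M))" using Jp[OF a(1,2) x(1,2)] x(3) by simp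
  qed
qed

text \<open>In one direction \<open>J\<close> is the product of the two constants; in the other a
  constant \<open>J\<close> fixes the singular values through
  \<open>K_set_sigma_cong\<close>.\<close>

lemma singular_values_constant_iff:
  assumes conn: "connected_space (topo M)"
  shows "(\<exists>s1 s2. differential_satisfies M N \<phi> (\<lambda>G H A. sigma1 G H A = s1 \<and> sigma2 G H A = s2)) \<longleftrightarrow>
    (\<forall>c\<in>charts M. \<forall>d\<in>charts N. \<forall>z\<in>local_dom c d \<phi>. \<forall>i. pderiv_on (local_dom c d \<phi>) i (J c d) z = 0)"
proof
  assume "\<exists>s1 s2. differential_satisfies M N \<phi> (\<lambda>G H A. sigma1 G H A = s1 \<and> sigma2 G H A = s2)"
  then obtain s1 s2 where s: "differential_satisfies M N \<phi> (\<lambda>G H A. sigma1 G H A = s1 \<and> sigma2 G H A = s2)"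
    by blast
  show "\<forall>c\<in>charts M. \<forall>d\<in>charts N. \<forall>z\<in>local_dom c d \<phi>. \<forall>i. pderiv_on (local_dom c d \<phi>) i (J c d) z = 0"
  proof (intro ballI allI)
    fix c d z i assume a: "c \<in> charts M" "d \<in> charts N" "z \<in> local_dom c d \<phi>"
    have "J c d y = s1 * s2" if y: "y \<in> local_dom c d \<phi>" for y
    proof -
      have "sigma1 (metric M c y) (metric N d (local_rep c d \<phi> y)) (local_differential c d \<phi> y) = s1"
        "sigma2 (metric M c y) (metric N d (local_rep c d \<phi> y)) (local_differential c d \<phi> y) = s2"
        using s a y by (simp_all add: differential_satisfies_def)
      then show ?thesis
        using singular_values(1)[OF local_gram[OF a(1,2) y], of "local_differential c d \<phi> y"]
          local_K(2)[OF a(1,2) y] by (simp add: J_def)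
    qed
    then have "pderiv_on (local_dom c d \<phi>) i (J c d) z = pderiv_on (local_dom c d \<phi>) i (\<lambda>_. s1 * s2) z"
      by (intro pderiv_on_cong a)
    also have "\<dots> = 0"
      by (rule pderiv_on_eqI[OF local_dom_region[OF a(1,2)] a(3) has_derivative_const])
    finally show "pderiv_on (local_dom c d \<phi>) i (J c d) z = 0" .
  qed
next
  assume "\<forall>c\<in>charts M. \<forall>d\<in>charts N. \<forall>z\<in>local_dom c d \<phi>. \<forall>i. pderiv_on (local_dom c d \<phi>) i (J c d) z = 0"
  then obtain j where j: "\<And>c d z. c \<in> charts M \<Longrightarrow> d \<in> charts N \<Longrightarrow> z \<in> local_dom c d \<phi> \<Longrightarrow> J c d z = j"
    using J_constant[OF conn] by metis
  show "\<exists>s1 s2. differential_satisfies M N \<phi> (\<lambda>G H A. sigma1 G H A = s1 \<and> sigma2 G H A = s2)"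
  \<comment> \<open>One point supplies the two constants for all others; if there is no point at
    all, any constants do.\<close>
  proof (cases "\<exists>c d z. c \<in> charts M \<and> d \<in> charts N \<and> z \<in> local_dom c d \<phi>")
    case True
    then obtain c0 d0 z0 where a0: "c0 \<in> charts M" "d0 \<in> charts N" "z0 \<in> local_dom c0 d0 \<phi>" by blast
    let ?G = "metric M c0 z0" and ?H = "metric N d0 (local_rep c0 d0 \<phi> z0)"
      and ?A = "local_differential c0 d0 \<phi> z0"
    have "differential_satisfies M N \<phi> (\<lambda>G H A. sigma1 G H A = sigma1 ?G ?H ?A \<and> sigma2 G H A = sigma2 ?G ?H ?A)"
      unfolding differential_satisfies_def
    proof (intro ballI)
      fix c d z assume a: "c \<in> charts M" "d \<in> charts N" "z \<in> local_dom c d \<phi>"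
      have "J c d z = J c0 d0 z0" using j[OF a] j[OF a0] by simp
      then show "sigma1 (metric M c z) (metric N d (local_rep c d \<phi> z)) (local_differential c d \<phi> z) = sigma1 ?G ?H ?A \<and>
          sigma2 (metric M c z) (metric N d (local_rep c d \<phi> z)) (local_differential c d \<phi> z) = sigma2 ?G ?H ?A"
        unfolding J_def
        using K_set_sigma_cong[OF local_gram[OF a] local_K(1)[OF a] local_gram[OF a0] local_K(1)[OF a0]] by blast
    qed
    then show ?thesis by blast
  next
    case False
    then show ?thesis unfolding differential_satisfies_def by blast
  qed
qed

end

theorem proposition1p6:
  fixes M :: "'a surface" and N :: "'b surface" and \<phi> :: "'a \<Rightarrow> 'b"
  assumes "oriented_riemannian_surface M" "compact_space (topo M)" "connected_space (topo M)"
    and "oriented_riemannian_surface N" "compact_space (topo N)" "connected_space (topo N)"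
    and "C2_map M N \<phi>"
    and "differential_satisfies M N \<phi> (\<lambda>G H A. metric_det G H A > 0)"
    and "differential_satisfies M N \<phi> (\<lambda>G H A. A \<in> K_set G H)"
  shows "critical_point 2 M N \<phi> \<and>
    (\<forall>p::real. p \<ge> 1 \<and> p \<noteq> 2 \<longrightarrow>
       (critical_point p M N \<phi> \<longleftrightarrow>
        (\<exists>s1 s2. differential_satisfies M N \<phi>
           (\<lambda>G H A. sigma1 G H A = s1 \<and> sigma2 G H A = s2))))"
proof -
  interpret K_map M N \<phi> by (rule K_map.intro) fact+
  show ?thesis
    unfolding critical_point_iff singular_values_constant_iff[OF assms(3)] by simp
qed

end
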